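(* Let $\mathcal{X}$ be a Polish space, $\gamma$ a (reference) measure on $\mathcal{X}$ and $I:\mathcal{X}\to[0,\infty]$ a rate function that is continuous on its domain of finiteness. Suppose that for every $\varepsilon\in(0,\infty)$ the probability measure $\mu^\varepsilon$ on $\mathcal{X}$ has the form $\mu^\varepsilon(dx)=\frac{1}{Z^\varepsilon}e^{-\frac1\varepsilon I(x)}\gamma(dx)$, and that $\{\mu^\varepsilon\}$ satisfies the large deviation principle as $\varepsilon\to0$ with rate function $I$ and scaling $\varepsilon$. Let $F:\mathcal{X}\to\mathbb{R}$ be continuous and bounded below. Then for every integer $K\ge1$ and every $\boldsymbol{\alpha}=(\alpha_1,\dots,\alpha_K)$ with $1=\alpha_1\ge\alpha_2\ge\cdots\ge\alpha_K>0$, $$\lim_{\varepsilon\to0}-\varepsilon\log E\left[\left(\hat\eta^\varepsilon(\mathbf{X}^\varepsilon;\boldsymbol{\alpha})\right)^2\right]=V_F(\boldsymbol{\alpha}),$$ where $\hat\eta^\varepsilon(\mathbf{X}^\varepsilon;\boldsymbol{\alpha})$ is the $K$-temperature INS estimator and $V_F(\boldsymbol{\alpha})$ the variational quantity, both defined in the context.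
   Context: A rate function is a map $I:\mathcal{X}\to[0,\infty]$ with $\{I\le M\}$ compact for every $M\in[0,\infty)$. "Continuous on its domain of finiteness" means that the restriction of $I$ to $\{I<\infty\}$ (subspace topology) is continuous. $\{\mu^\varepsilon\}$ satisfies the large deviation principle (LDP) with rate function $I$ and scaling $\varepsilon$ if $\limsup_{\varepsilon\to0}\varepsilon\log\mu^\varepsilon(C)\le-\inf_C I$ for every closed $C$ and $\liminf_{\varepsilon\to0}\varepsilon\log\mu^\varepsilon(O)\ge-\inf_O I$ for every open $O$. $Z^\varepsilon=\int e^{-I/\varepsilon}d\gamma\in(0,\infty)$ is the normalizing constant. $\Sigma_K$ is the set of permutations of $\{1,\dots,K\}$. For $\mathbf{x}=(x_1,\dots,x_K)\in\mathcal{X}^K$ define the weight $$\rho^\varepsilon(\mathbf{x};\boldsymbol{\alpha})=\frac{e^{-\frac1\varepsilon\sum_{j=1}^K\alpha_jI(x_j)}}{\sum_{\tau\in\Sigma_K}e^{-\frac1\varepsilon\sum_{j=1}^K\alpha_jI(x_{\tau(j)})}}$$ ($e^{-\infty}=0$; the value when the denominator vanishes is irrelevant, say $0$, since this occurs with probability $0$ below). Let $X_1^\varepsilon,\dots,X_K^\varepsilon$ be independent with $X_j^\varepsilon\sim\mu^{\varepsilon/\alpha_j}$, $\mathbf{X}^\varepsilon=(X_1^\varepsilon,\dots,X_K^\varepsilon)$ and $\mathbf{X}^\varepsilon_\sigma=(X^\varepsilon_{\sigma(1)},\dots,X^\varepsilon_{\sigma(K)})$ for $\sigma\in\Sigma_K$.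 The $K$-temperature INS estimator is $$\hat\eta^\varepsilon(\mathbf{X}^\varepsilon;\boldsymbol{\alpha})=\sum_{\sigma\in\Sigma_K}\rho^\varepsilon(\mathbf{X}^\varepsilon_\sigma;\boldsymbol{\alpha})\,e^{-\frac1\varepsilon F(X^\varepsilon_{\sigma(1)})}.$$ With $D=\{(I(x),F(x)):x\in\mathcal{X},\ I(x)<\infty\}$, $$V_F(\boldsymbol{\alpha})=\inf\left\{2\sum_{j=1}^K\alpha_jI_j+2F-\min_{\sigma\in\Sigma_K}\sum_{j=1}^K\alpha_jI_{\sigma(j)}\ :\ (I_1,F)\in D,\ I_j\in[0,I_1]\text{ for }j=2,\dots,K\right\},$$ where inside the braces $F$ denotes the second coordinate of a point of $D$. *)

theory Defs
  imports "HOL-Probability.Probability" "HOL-Combinatorics.Permutations"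
begin

definition rate_function :: "('a::topological_space \<Rightarrow> ennreal) \<Rightarrow> bool" where
  "rate_function I \<longleftrightarrow> (\<forall>M<\<infinity>. compact {x. I x \<le> M})"

(* exp (- a) on [0, \<infinity>], with exp (- \<infinity>) = 0 *)
definition neg_exp :: "ennreal \<Rightarrow> real" where
  "neg_exp a = (if a = \<infinity> then 0 else exp (- enn2real a))"

(* logarithm of a nonnegative real, with log 0 = -\<infinity> (the library has ln 0 = 0) *)
definition ln_ereal :: "real \<Rightarrow> ereal" where
  "ln_ereal p = (if p = 0 then -\<infinity> else ereal (ln p))"

(* A bound on the infimum over the empty set reads -\<infinity>, since Inf {} = \<infinity> in ennreal. *)
definition satisfies_LDP ::
    "(real \<Rightarrow> 'a::topological_space measure) \<Rightarrow> ('a \<Rightarrow> ennreal) \<Rightarrow> bool" where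
  "satisfies_LDP \<mu> I \<longleftrightarrow>
     (\<forall>C. closed C \<longrightarrow>
        Limsup (at_right 0) (\<lambda>\<epsilon>. ereal \<epsilon> * ln_ereal (measure (\<mu> \<epsilon>) C))
          \<le> - enn2ereal (INF x\<in>C. I x)) \<and>
     (\<forall>U. open U \<longrightarrow>
        Liminf (at_right 0) (\<lambda>\<epsilon>. ereal \<epsilon> * ln_ereal (measure (\<mu> \<epsilon>) U))
          \<ge> - enn2ereal (INF x\<in>U. I x))"

definition gibbs_Z :: "'a measure \<Rightarrow> ('a \<Rightarrow> ennreal) \<Rightarrow> real \<Rightarrow> ennreal" where
  "gibbs_Z \<gamma> I \<epsilon> = (\<integral>\<^sup>+ x. ennreal (neg_exp (ennreal (1 / \<epsilon>) * I x)) \<partial>\<gamma>)"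

definition gibbs_measure :: "'a measure \<Rightarrow> ('a \<Rightarrow> ennreal) \<Rightarrow> real \<Rightarrow> 'a measure" where
  "gibbs_measure \<gamma> I \<epsilon> =
     density \<gamma> (\<lambda>x. ennreal (neg_exp (ennreal (1 / \<epsilon>) * I x)) / gibbs_Z \<gamma> I \<epsilon>)"

(* Points of the K-fold product are functions on nat of which only the values at 1, ..., K matter. *)
definition INS_exponent ::
    "('a \<Rightarrow> ennreal) \<Rightarrow> nat \<Rightarrow> (nat \<Rightarrow> real) \<Rightarrow> real \<Rightarrow> (nat \<Rightarrow> 'a) \<Rightarrow> ennreal" where
  "INS_exponent I K \<alpha> \<epsilon> x = ennreal (1 / \<epsilon>) * (\<Sum>j=1..K. ennreal (\<alpha> j) * I (x j))"

(* If the denominator vanishes, the value is 0, since division by 0 gives 0. *)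
definition INS_weight ::
    "('a \<Rightarrow> ennreal) \<Rightarrow> nat \<Rightarrow> (nat \<Rightarrow> real) \<Rightarrow> real \<Rightarrow> (nat \<Rightarrow> 'a) \<Rightarrow> real" where
  "INS_weight I K \<alpha> \<epsilon> x =
     neg_exp (INS_exponent I K \<alpha> \<epsilon> x) /
     (\<Sum>\<tau> | \<tau> permutes {1..K}. neg_exp (INS_exponent I K \<alpha> \<epsilon> (\<lambda>j. x (\<tau> j))))"

definition INS_estimator ::
    "('a \<Rightarrow> ennreal) \<Rightarrow> ('a \<Rightarrow> real) \<Rightarrow> nat \<Rightarrow> (nat \<Rightarrow> real) \<Rightarrow> real \<Rightarrow> (nat \<Rightarrow> 'a) \<Rightarrow> real" where
  "INS_estimator I F K \<alpha> \<epsilon> x =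
     (\<Sum>\<sigma> | \<sigma> permutes {1..K}.
        INS_weight I K \<alpha> \<epsilon> (\<lambda>j. x (\<sigma> j)) * exp (- (1 / \<epsilon>) * F (x (\<sigma> 1))))"

definition finite_rate_pairs ::
    "('a \<Rightarrow> ennreal) \<Rightarrow> ('a \<Rightarrow> real) \<Rightarrow> (real \<times> real) set" where
  "finite_rate_pairs I F = {(enn2real (I x), F x) | x. I x < \<infinity>}"

(* An infimum in the reals: the set is nonempty and bounded below when I is finite somewhere,
   F is bounded below and \<alpha> is nonnegative on {1..K}. *)
definition V_F ::
    "('a \<Rightarrow> ennreal) \<Rightarrow> ('a \<Rightarrow> real) \<Rightarrow> nat \<Rightarrow> (nat \<Rightarrow> real) \<Rightarrow> real" where
  "V_F I F K \<alpha> =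
     Inf {2 * (\<Sum>j=1..K. \<alpha> j * J j) + 2 * f
            - Min ((\<lambda>\<sigma>. \<Sum>j=1..K. \<alpha> j * J (\<sigma> j)) ` {\<sigma>. \<sigma> permutes {1..K}})
          | J f. (J 1, f) \<in> finite_rate_pairs I F \<and> (\<forall>j\<in>{2..K}. J j \<in> {0..J 1})}"

end

theory Submission
  imports Defs
begin

text \<open>Write \<open>J j = I (x j)\<close> and let \<open>M\<close> be the minimum of \<open>\<Sum>j. \<alpha> j * J (\<tau> j)\<close> over permutations \<open>\<tau>\<close>.
  Up to factors \<open>K!\<close>, the weight of a permutation \<open>\<sigma>\<close> is
  \<open>exp (- (\<Sum>j. \<alpha> j * J (\<sigma> j) - M) / \<epsilon>)\<close>.

  The function \<open>h J = 2 * (\<Sum>j. \<alpha> j * J j) - M\<close> is additive along the superlevel sets of \<open>J\<close>, by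
  rearrangement. Hence at fixed \<open>J 1\<close> its infimum over all \<open>J \<ge> 0\<close>, also those exceeding \<open>J 1\<close>, is
  attained with entries in \<open>{0, J 1}\<close>, and these are values of \<open>I\<close>, since \<open>inf I = 0\<close> is attained.
  So neither the constraint \<open>J j \<in> [0, J 1]\<close> nor gaps in the range of \<open>I\<close> affect \<open>V\<close>.

  Upper bound: as \<open>M \<le> \<Sum>j. \<alpha> j * J j\<close>, the squared estimator is at most a constant times
  \<open>exp (- V / \<epsilon>) * \<Prod>j. exp (\<alpha> j * I (x j) / \<epsilon>)\<close>; after truncating \<open>I\<close> the expectation of the product
  factorizes, and by the large deviation upper bound each factor is subexponential.

  Lower bound: rearrange a nearly optimal point \<open>x\<close> by a permutation attaining \<open>M\<close> and restrict
  the expectation to a small neighbourhood of the result, whose probability is about \<open>exp (- M / \<epsilon>)\<close>.\<close>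

section \<open>Permutation costs and rearrangement\<close>

definition perm_cost :: "(nat \<Rightarrow> real) \<Rightarrow> nat \<Rightarrow> (nat \<Rightarrow> real) \<Rightarrow> (nat \<Rightarrow> nat) \<Rightarrow> real" where
  "perm_cost \<alpha> K J \<sigma> = (\<Sum>j=1..K. \<alpha> j * J (\<sigma> j))"

definition min_cost :: "(nat \<Rightarrow> real) \<Rightarrow> nat \<Rightarrow> (nat \<Rightarrow> real) \<Rightarrow> real" where
  "min_cost \<alpha> K J = Min (perm_cost \<alpha> K J ` {\<sigma>. \<sigma> permutes {1..K}})"

text \<open>With \<open>J\<close> the rates of a point, this is the exponential price of its
  contribution to the second moment, \<open>F\<close> aside. The identity term of the estimator
  costs \<open>(\<Sum>j=1..K. \<alpha> j * J j) - min_cost \<alpha> K J\<close>, squaring doubles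
  this, and the cheapest rearrangement of the point has a probability of exponent
  \<open>min_cost \<alpha> K J\<close>.\<close>

definition excess_cost :: "(nat \<Rightarrow> real) \<Rightarrow> nat \<Rightarrow> (nat \<Rightarrow> real) \<Rightarrow> real" where
  "excess_cost \<alpha> K J = 2 * (\<Sum>j=1..K. \<alpha> j * J j) - min_cost \<alpha> K J"

lemma min_cost_le:
  assumes "\<sigma> permutes {1..K}"
  shows "min_cost \<alpha> K J \<le> perm_cost \<alpha> K J \<sigma>"
  unfolding min_cost_def using assms by (intro Min_le finite_imageI finite_permutations) auto

lemma min_cost_attained:
  obtains \<sigma> where "\<sigma> permutes {1..K}" "min_cost \<alpha> K J = perm_cost \<alpha> K J \<sigma>"
proof -
  have "min_cost \<alpha> K J \<in> perm_cost \<alpha> K J ` {\<sigma>. \<sigma> permutes {1..K}}"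
    unfolding min_cost_def
    by (intro Min_in finite_imageI finite_permutations) (auto intro: permutes_id)
  then show ?thesis using that by auto
qed

lemma min_cost_le_sum: "min_cost \<alpha> K J \<le> (\<Sum>j=1..K. \<alpha> j * J j)"
  using min_cost_le[OF permutes_id, of \<alpha> K J] by (simp add: perm_cost_def)

lemma min_cost_scale_ge:
  assumes "0 \<le> c"
  shows "c * min_cost \<alpha> K J \<le> min_cost \<alpha> K (\<lambda>j. c * J j)"
proof -
  obtain \<sigma> where \<sigma>: "\<sigma> permutes {1..K}"
      "min_cost \<alpha> K (\<lambda>j. c * J j) = perm_cost \<alpha> K (\<lambda>j. c * J j) \<sigma>"
    using min_cost_attained .
  have "c * min_cost \<alpha> K J \<le> c * perm_cost \<alpha> K J \<sigma>"
    using \<sigma>(1) assms by (intro mult_left_mono min_cost_le)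
  also have "\<dots> = min_cost \<alpha> K (\<lambda>j. c * J j)"
    unfolding \<sigma>(2) by (simp add: perm_cost_def sum_distrib_left mult.left_commute)
  finally show ?thesis .
qed

text \<open>Left composition with \<open>\<sigma>\<close> permutes the set of permutations, so both
  minima run over the same costs.\<close>

lemma min_cost_permute:
  assumes "\<sigma> permutes {1..K}"
  shows "min_cost \<alpha> K (\<lambda>j. J (\<sigma> j)) = min_cost \<alpha> K J"
proof -
  have "perm_cost \<alpha> K (\<lambda>j. J (\<sigma> j)) = perm_cost \<alpha> K J \<circ> (\<circ>) \<sigma>"
    by (auto simp: perm_cost_def fun_eq_iff)
  moreover have "(\<circ>) \<sigma> ` {\<tau>. \<tau> permutes {1..K}} = {\<tau>. \<tau> permutes {1..K}}"
    using image_compose_permutations_left[OF assms] by (auto simp: image_def)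
  ultimately show ?thesis unfolding min_cost_def by (metis image_comp)
qed

lemma ex_sorting_permutation:
  fixes J :: "nat \<Rightarrow> 'b::linorder"
  obtains \<tau> where "\<tau> permutes {1..K}" "mono_on {1..K} (\<lambda>j. J (\<tau> j))"
proof -
  define xs where "xs = sort_key J [1..<Suc K]"
  \<comment> \<open>The sorted list of indices read as a function: list positions start at 0,
    arguments at 1, and \<open>permutes\<close> asks for the identity outside
    \<open>{1..K}\<close>.\<close>
  define \<tau> where "\<tau> = (\<lambda>j. if j \<in> {1..K} then xs ! (j - 1) else j)"
  have len: "length xs = K" and dist: "distinct xs" and set: "set xs = {1..K}"
    by (auto simp: xs_def)
  have "bij_betw (\<lambda>j. j - 1) {1..K} {..<K}"
    by (rule bij_betw_byWitness[where f' = Suc]) auto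
  moreover have "bij_betw ((!) xs) {..<K} {1..K}"
    using dist len set by (intro bij_betw_nth) auto
  ultimately have "bij_betw ((!) xs \<circ> (\<lambda>j. j - 1)) {1..K} {1..K}"
    by (rule bij_betw_trans)
  then have "bij_betw \<tau> {1..K} {1..K}"
    by (rule iffD1[OF bij_betw_cong, rotated]) (auto simp: \<tau>_def)
  then have "\<tau> permutes {1..K}"
    by (rule bij_imp_permutes) (auto simp: \<tau>_def)
  moreover have "mono_on {1..K} (\<lambda>j. J (\<tau> j))"
  proof (rule mono_onI)
    fix i j assume ij: "i \<in> {1..K}" "j \<in> {1..K}" "i \<le> j"
    have "sorted (map J xs)" by (simp add: xs_def)
    then have "map J xs ! (i - 1) \<le> map J xs ! (j - 1)"
      using ij len by (intro sorted_nth_mono) auto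
    moreover have "i - 1 < length xs" "j - 1 < length xs" using ij len by auto
    ultimately show "J (\<tau> i) \<le> J (\<tau> j)" using ij by (simp add: \<tau>_def)
  qed
  ultimately show ?thesis by (rule that)
qed

text \<open>Exchange argument: cancel \<open>A \<inter> B\<close>. The remainders have equal
  cardinality, and as \<open>A\<close> is closed upwards in \<open>S\<close>, every element of
  \<open>B - A\<close> lies below every element of \<open>A - B\<close>, where
  \<open>\<alpha>\<close> is no larger.\<close>

lemma sum_upper_set_le:
  fixes \<alpha> :: "nat \<Rightarrow> real"
  assumes "finite S" "A \<subseteq> S" "B \<subseteq> S" "card A = card B" "antimono_on S \<alpha>"
    and up: "\<And>i k. i \<in> A \<Longrightarrow> k \<in> S \<Longrightarrow> i \<le> k \<Longrightarrow> k \<in> A"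
  shows "sum \<alpha> A \<le> sum \<alpha> B"
proof -
  have fin: "finite A" "finite B" using assms finite_subset by blast+
  have card: "card (A - B) = card (B - A)"
    using assms(4) fin by (simp add: card_Diff_subset_Int Int_commute)
  have "sum \<alpha> (A - B) \<le> sum \<alpha> (B - A)"
  proof (cases "A - B = {}")
    case True
    then have "B - A = {}" using card fin by (metis card.empty card_0_eq finite_Diff)
    with True show ?thesis by simp
  next
    case False
    \<comment> \<open>A threshold between the two remainders: no value of \<open>\<alpha>\<close> on
      \<open>A - B\<close> exceeds it, and no value on \<open>B - A\<close> falls below it.\<close>
    define c where "c = Max (\<alpha> ` (A - B))"
    have "sum \<alpha> (A - B) \<le> card (A - B) * c"
      unfolding c_def using fin by (intro sum_bounded_above[where 'a = real]) auto
    also have "\<dots> = card (B - A) * c" by (simp add: card)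
    also have "\<dots> \<le> sum \<alpha> (B - A)"
    proof (rule sum_bounded_below)
      fix k assume k: "k \<in> B - A"
      have "\<alpha> i \<le> \<alpha> k" if "i \<in> A - B" for i
      proof -
        have "k \<le> i" using up[of i k] that k assms(3) by (cases "k \<le> i") auto
        then show ?thesis using assms(2,3,5) that k by (auto simp: monotone_on_def)
      qed
      then show "c \<le> \<alpha> k" unfolding c_def using False fin by (intro Max.boundedI) auto
    qed
    finally show ?thesis .
  qed
  moreover have "sum \<alpha> A = sum \<alpha> (A \<inter> B) + sum \<alpha> (A - B)"
    "sum \<alpha> B = sum \<alpha> (A \<inter> B) + sum \<alpha> (B - A)"
    using sum.Int_Diff[OF fin(1), of \<alpha> B] sum.Int_Diff[OF fin(2), of \<alpha> A] by (auto simp: Int_commute)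
  ultimately show ?thesis by simp
qed

text \<open>A permutation sorting \<open>J\<close> is optimal for all superlevel sets of \<open>J\<close> at once;
  this is what makes \<open>excess_cost\<close> additive along the layer-cake decomposition of \<open>J\<close>.\<close>

lemma min_cost_superlevel:
  fixes J :: "nat \<Rightarrow> real"
  assumes \<alpha>: "antimono_on {1..K} \<alpha>"
    and \<tau>: "\<tau> permutes {1..K}" "mono_on {1..K} (\<lambda>j. J (\<tau> j))"
  shows "min_cost \<alpha> K (\<lambda>j. of_bool (t < J j)) = perm_cost \<alpha> K (\<lambda>j. of_bool (t < J j)) \<tau>"
proof (rule antisym)
  show "min_cost \<alpha> K (\<lambda>j. of_bool (t < J j)) \<le> perm_cost \<alpha> K (\<lambda>j. of_bool (t < J j)) \<tau>"
    by (rule min_cost_le[OF \<tau>(1)])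
  define L where "L \<pi> = {j \<in> {1..K}. t < J (\<pi> j)}" for \<pi> :: "nat \<Rightarrow> nat"
  have cost: "perm_cost \<alpha> K (\<lambda>j. of_bool (t < J j)) \<pi> = sum \<alpha> (L \<pi>)" for \<pi>
  proof -
    have "sum \<alpha> (L \<pi>) = (\<Sum>j=1..K. if t < J (\<pi> j) then \<alpha> j else 0)"
      unfolding L_def by (rule sum.inter_filter) simp
    also have "\<dots> = perm_cost \<alpha> K (\<lambda>j. of_bool (t < J j)) \<pi>"
      unfolding perm_cost_def by (rule sum.cong) auto
    finally show ?thesis by simp
  qed
  \<comment> \<open>\<open>\<pi>\<close> maps \<open>L \<pi>\<close> bijectively onto the superlevel
    set \<open>L id\<close>, so all these sets have the same size and can be compared by
    exchange.\<close>
  have card: "card (L \<pi>) = card (L id)" if "\<pi> permutes {1..K}" for \<pi>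
  proof -
    have "\<pi> ` L \<pi> = L id"
    proof
      show "\<pi> ` L \<pi> \<subseteq> L id" using permutes_in_image[OF that] by (auto simp: L_def)
      show "L id \<subseteq> \<pi> ` L \<pi>"
      proof
        fix j assume j: "j \<in> L id"
        then have "j \<in> \<pi> ` {1..K}" using permutes_image[OF that] by (auto simp: L_def)
        with j show "j \<in> \<pi> ` L \<pi>" by (auto simp: L_def)
      qed
    qed
    moreover have "inj_on \<pi> (L \<pi>)" using permutes_inj_on[OF that] .
    ultimately show ?thesis using card_image by metis
  qed
  obtain \<sigma> where \<sigma>: "\<sigma> permutes {1..K}"
      "min_cost \<alpha> K (\<lambda>j. of_bool (t < J j)) = perm_cost \<alpha> K (\<lambda>j. of_bool (t < J j)) \<sigma>"
    using min_cost_attained .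
  \<comment> \<open>\<open>J\<close> increases along \<open>\<tau>\<close>, so
    \<open>L \<tau>\<close> is a final segment of \<open>{1..K}\<close>, where the decreasing
    \<open>\<alpha>\<close> is smallest.\<close>
  have "sum \<alpha> (L \<tau>) \<le> sum \<alpha> (L \<sigma>)"
  proof (rule sum_upper_set_le[where S = "{1..K}"])
    show "card (L \<tau>) = card (L \<sigma>)" using card \<tau>(1) \<sigma>(1) by metis
    fix i k assume "i \<in> L \<tau>" "k \<in> {1..K}" "i \<le> k"
    then show "k \<in> L \<tau>" using mono_onD[OF \<tau>(2), of i k] by (auto simp: L_def)
  qed (use \<alpha> in \<open>auto simp: L_def\<close>)
  then show "perm_cost \<alpha> K (\<lambda>j. of_bool (t < J j)) \<tau> \<le> min_cost \<alpha> K (\<lambda>j. of_bool (t < J j))"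
    by (simp add: \<sigma>(2) cost)
qed

section \<open>Reduction to two-valued rate vectors\<close>

text \<open>Integrate the level sums over \<open>t \<ge> 0\<close>: the indicator of
  \<open>t < J j\<close> contributes \<open>J j\<close>. The coefficients may have either sign,
  which is why both bounds concern the whole sum and not its terms.\<close>

lemma layer_cake_ge:
  fixes c J :: "'b \<Rightarrow> real"
  assumes "finite S" "\<And>j. j \<in> S \<Longrightarrow> 0 \<le> J j" "0 \<le> a"
    and nonneg: "\<And>t. 0 \<le> t \<Longrightarrow> 0 \<le> (\<Sum>j\<in>S. c j * of_bool (t < J j))"
    and m: "\<And>t. 0 \<le> t \<Longrightarrow> t < a \<Longrightarrow> m \<le> (\<Sum>j\<in>S. c j * of_bool (t < J j))"
  shows "a * m \<le> (\<Sum>j\<in>S. c j * J j)"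
proof -
  have "a * m = (\<integral>t. m * indicator {0..<a} t \<partial>lborel)" using assms(3) by simp
  also have "\<dots> \<le> (\<integral>t. (\<Sum>j\<in>S. c j * indicator {0..<J j} t) \<partial>lborel)"
  proof (rule integral_mono)
    fix t :: real
    have "(\<Sum>j\<in>S. c j * indicator {0..<J j} t) = (if 0 \<le> t then (\<Sum>j\<in>S. c j * of_bool (t < J j)) else 0)"
      by (auto simp: indicator_def intro!: sum.cong)
    then show "m * indicator {0..<a} t \<le> (\<Sum>j\<in>S. c j * indicator {0..<J j} t)"
      using nonneg[of t] m[of t] by (auto simp: indicator_def)
  next
    show "integrable lborel (\<lambda>t. \<Sum>j\<in>S. c j * indicator {0..<J j} t)"
      using assms(2) by (intro Bochner_Integration.integrable_sum integrable_mult_right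
          integrable_real_indicator) auto
  qed (use assms(3) in simp)
  also have "\<dots> = (\<Sum>j\<in>S. c j * J j)"
    using assms(2) by (subst Bochner_Integration.integral_sum) auto
  finally show ?thesis .
qed

text \<open>The minimum is at most the sum itself, so one copy of a nonnegative sum remains.\<close>

lemma excess_cost_nonneg:
  assumes "\<And>j. j \<in> {1..K} \<Longrightarrow> 0 \<le> \<alpha> j" "\<And>j. j \<in> {1..K} \<Longrightarrow> 0 \<le> J j"
  shows "0 \<le> excess_cost \<alpha> K J"
  using min_cost_le_sum[of \<alpha> K J] sum_nonneg[of "{1..K}" "\<lambda>j. \<alpha> j * J j"] assms
  by (auto simp: excess_cost_def)

text \<open>For one sorting permutation \<open>\<tau>\<close>, the excess costs of all superlevel
  indicators are given by a single linear form with coefficients \<open>c\<close>, and at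
  \<open>J\<close> itself this form is at most \<open>excess_cost \<alpha> K J\<close>. The cheapest
  level \<open>s < J 1\<close> costs no more than the average over the levels below
  \<open>J 1\<close>, and higher levels only add nonnegative terms. The witness is
  \<open>J 1\<close> times the indicator at level \<open>s\<close>.\<close>

lemma excess_cost_two_valued:
  assumes K: "1 \<le> K" and \<alpha>: "antimono_on {1..K} \<alpha>" "\<And>j. j \<in> {1..K} \<Longrightarrow> 0 \<le> \<alpha> j"
    and J: "\<And>j. j \<in> {1..K} \<Longrightarrow> 0 \<le> J j"
  obtains J' where "J' 1 = J 1" "\<And>j. J' j \<in> {0, J 1}" "excess_cost \<alpha> K J' \<le> excess_cost \<alpha> K J"
proof -
  define u where "u t = excess_cost \<alpha> K (\<lambda>j. of_bool (t < J j))" for t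
  obtain \<tau> where \<tau>: "\<tau> permutes {1..K}" "mono_on {1..K} (\<lambda>j. J (\<tau> j))"
    using ex_sorting_permutation .
  \<comment> \<open>Reindexing by \<open>inv \<tau>\<close> turns the cost of \<open>\<tau>\<close>
    into a linear form in the entries.\<close>
  define c where "c j = 2 * \<alpha> j - \<alpha> (inv \<tau> j)" for j
  have lin: "2 * (\<Sum>j=1..K. \<alpha> j * H j) - perm_cost \<alpha> K H \<tau> = (\<Sum>j=1..K. c j * H j)" for H
  proof -
    have "perm_cost \<alpha> K H \<tau> = (\<Sum>j=1..K. \<alpha> (inv \<tau> j) * H j)"
      unfolding perm_cost_def
      by (subst sum.permute[OF \<tau>(1)]) (simp add: o_def permutes_inverses[OF \<tau>(1)])
    then show ?thesis
      by (simp add: c_def sum_distrib_left sum_subtractf algebra_simps)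
  qed
  have u: "u t = (\<Sum>j=1..K. c j * of_bool (t < J j))" for t
    unfolding u_def excess_cost_def min_cost_superlevel[OF \<alpha>(1) \<tau>] by (rule lin)
  have nonneg: "0 \<le> excess_cost \<alpha> K H" if "\<And>j. j \<in> {1..K} \<Longrightarrow> 0 \<le> H j" for H
    using \<alpha>(2) that by (rule excess_cost_nonneg)
  have J_ge: "(\<Sum>j=1..K. c j * J j) \<le> excess_cost \<alpha> K J"
    using min_cost_le[OF \<tau>(1), of \<alpha> J] lin[of J] by (simp add: excess_cost_def)
  show ?thesis
  proof (cases "J 1 = 0")
    case True
    \<comment> \<open>No level lies below \<open>J 1\<close> in this case; the zero vector serves
      instead.\<close>
    have "excess_cost \<alpha> K (\<lambda>_. 0) = 0"
    proof -
      obtain \<sigma> where "min_cost \<alpha> K (\<lambda>_. 0) = perm_cost \<alpha> K (\<lambda>_. 0) \<sigma>" using min_cost_attained .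
      then show ?thesis by (simp add: excess_cost_def perm_cost_def)
    qed
    with True nonneg[OF J] show ?thesis by (intro that[of "\<lambda>_. 0"]) auto
  next
    case False
    then have pos: "0 < J 1" using J[of 1] K by simp
    \<comment> \<open>\<open>u t\<close> depends on \<open>t\<close> only through the set of indices
      with \<open>t < J j\<close>. There are finitely many such sets, so the minimum over a
      continuum of levels is attained.\<close>
    have "u ` {0..<J 1} \<subseteq> (\<lambda>S. \<Sum>j=1..K. c j * of_bool (j \<in> S)) ` Pow {1..K}"
    proof
      fix v assume "v \<in> u ` {0..<J 1}"
      then obtain t where "v = u t" by auto
      then have "v = (\<Sum>j=1..K. c j * of_bool (j \<in> {j \<in> {1..K}. t < J j}))" by (simp add: u)
      then show "v \<in> (\<lambda>S. \<Sum>j=1..K. c j * of_bool (j \<in> S)) ` Pow {1..K}" by blast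
    qed
    then have fin: "finite (u ` {0..<J 1})" by (rule finite_subset) auto
    then obtain s where s: "0 \<le> s" "s < J 1" and min: "\<And>t. 0 \<le> t \<Longrightarrow> t < J 1 \<Longrightarrow> u s \<le> u t"
    proof -
      have ne: "u ` {0..<J 1} \<noteq> {}" using pos by auto
      from Min_in[OF fin ne] obtain s where "s \<in> {0..<J 1}" "Min (u ` {0..<J 1}) = u s" by auto
      moreover have "Min (u ` {0..<J 1}) \<le> u t" if "0 \<le> t" "t < J 1" for t
        using that fin by (intro Min_le) auto
      ultimately show ?thesis using that by auto
    qed
    \<comment> \<open>As \<open>s < J 1\<close>, the index 1 belongs to the superlevel set and keeps
      its value.\<close>
    define J' where "J' j = J 1 * of_bool (s < J j)" for j
    have "excess_cost \<alpha> K J' \<le> J 1 * u s"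
    proof -
      have "(\<Sum>j=1..K. \<alpha> j * J' j) = J 1 * (\<Sum>j=1..K. \<alpha> j * of_bool (s < J j))"
        unfolding J'_def sum_distrib_left by (simp only: mult.left_commute)
      moreover have "J 1 * min_cost \<alpha> K (\<lambda>j. of_bool (s < J j)) \<le> min_cost \<alpha> K J'"
        unfolding J'_def using pos by (intro min_cost_scale_ge) simp
      ultimately show ?thesis by (simp add: excess_cost_def u_def right_diff_distrib)
    qed
    also have "\<dots> \<le> (\<Sum>j=1..K. c j * J j)"
    proof (rule layer_cake_ge)
      show "0 \<le> (\<Sum>j=1..K. c j * of_bool (t < J j))" for t
        unfolding u[symmetric] u_def by (rule nonneg) simp
    qed (use J pos min in \<open>auto simp: u\<close>)
    also note J_ge
    finally show ?thesis using s by (intro that[of J']) (auto simp: J'_def)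
  qed
qed

section \<open>The variational quantity\<close>

lemma V_F_eq:
  "V_F I F K \<alpha> = Inf {excess_cost \<alpha> K J + 2 * f | J f.
     (J 1, f) \<in> finite_rate_pairs I F \<and> (\<forall>j\<in>{2..K}. J j \<in> {0..J 1})}"
  unfolding V_F_def excess_cost_def min_cost_def perm_cost_def[abs_def]
  by (simp add: algebra_simps)

text \<open>The two-valued vector obtained from \<open>J\<close> has its entries 0 and
  \<open>J 1\<close> in \<open>[0, J 1]\<close>, so it is feasible for \<open>V_F\<close>. In this
  form the bound applies to the rates of any point, whichever coordinate has the largest
  rate.\<close>

lemma V_F_le_excess_cost:
  assumes K: "1 \<le> K" and \<alpha>: "antimono_on {1..K} \<alpha>" "\<And>j. j \<in> {1..K} \<Longrightarrow> 0 \<le> \<alpha> j"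
    and F: "bdd_below (range F)"
    and J: "(J 1, f) \<in> finite_rate_pairs I F" "\<And>j. j \<in> {1..K} \<Longrightarrow> 0 \<le> J j"
  shows "V_F I F K \<alpha> \<le> excess_cost \<alpha> K J + 2 * f"
proof -
  obtain J' where J': "J' 1 = J 1" "\<And>j. J' j \<in> {0, J 1}" "excess_cost \<alpha> K J' \<le> excess_cost \<alpha> K J"
    using excess_cost_two_valued[where J = J and \<alpha> = \<alpha>, OF K \<alpha> J(2)] by blast
  have J1: "0 \<le> J 1" using J(2) K by simp
  obtain b where b: "\<And>x. b \<le> F x" using F by (auto simp: bdd_below_def)
  have "V_F I F K \<alpha> \<le> excess_cost \<alpha> K J' + 2 * f"
    unfolding V_F_eq
  proof (rule cInf_lower)
    have "J' j \<in> {0..J' 1}" for j using J'(1) J'(2)[of j] J1 by auto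
    then show "excess_cost \<alpha> K J' + 2 * f \<in> {excess_cost \<alpha> K J + 2 * f | J f.
       (J 1, f) \<in> finite_rate_pairs I F \<and> (\<forall>j\<in>{2..K}. J j \<in> {0..J 1})}"
      using J(1) J'(1) by (intro CollectI exI[of _ J'] exI[of _ f]) auto
    show "bdd_below {excess_cost \<alpha> K J + 2 * f | J f.
       (J 1, f) \<in> finite_rate_pairs I F \<and> (\<forall>j\<in>{2..K}. J j \<in> {0..J 1})}"
      \<comment> \<open>The infimum is taken in the reals, so a lower bound has to be exhibited:
        excess costs are nonnegative and \<open>F\<close> is at least \<open>b\<close>.\<close>
      unfolding bdd_below_def
    proof (intro exI[of _ "2 * b"], clarify)
      fix H g assume H: "(H 1, g) \<in> finite_rate_pairs I F" "\<forall>j\<in>{2..K}. H j \<in> {0..H 1}"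
      then have "b \<le> g" "0 \<le> H 1" using b by (auto simp: finite_rate_pairs_def)
      moreover have "0 \<le> H j" if "j \<in> {1..K}" for j
        using H(2) that \<open>0 \<le> H 1\<close> by (cases "j = 1") auto
      ultimately show "2 * b \<le> excess_cost \<alpha> K H + 2 * g"
        using excess_cost_nonneg[of K \<alpha> H, OF \<alpha>(2)] by simp
    qed
  qed
  with J'(3) show ?thesis by simp
qed

text \<open>The entries of a feasible vector may fall into gaps of the range of \<open>I\<close>.
  After the two-valued reduction only the rates of \<open>x1\<close> and \<open>x0\<close> occur, so
  an actual point realizes the vector.\<close>

lemma V_F_approx:
  assumes K: "1 \<le> K" and \<alpha>: "antimono_on {1..K} \<alpha>" "\<And>j. j \<in> {1..K} \<Longrightarrow> 0 \<le> \<alpha> j"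
    and x0: "I x0 = 0" and "V_F I F K \<alpha> < v"
  obtains x where "\<And>j. I (x j) < \<infinity>"
    "excess_cost \<alpha> K (\<lambda>j. enn2real (I (x j))) + 2 * F (x 1) < v"
proof -
  let ?S = "{excess_cost \<alpha> K J + 2 * f | J f.
       (J 1, f) \<in> finite_rate_pairs I F \<and> (\<forall>j\<in>{2..K}. J j \<in> {0..J 1})}"
  have "?S \<noteq> {}"
    using x0 by (auto simp: finite_rate_pairs_def intro!: exI[of _ "\<lambda>_. 0"] exI[of _ x0])
  then obtain v' where "v' \<in> ?S" "v' < v"
    using cInf_lessD[of ?S v] assms(5) unfolding V_F_eq by blast
  then obtain J f where J: "excess_cost \<alpha> K J + 2 * f < v" "(J 1, f) \<in> finite_rate_pairs I F"
      "\<forall>j\<in>{2..K}. J j \<in> {0..J 1}" by auto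
  obtain x1 where x1: "J 1 = enn2real (I x1)" "f = F x1" "I x1 < \<infinity>"
    using J(2) by (auto simp: finite_rate_pairs_def)
  have "0 \<le> J j" if "j \<in> {1..K}" for j using J(3) that x1(1) by (cases "j = 1") auto
  then obtain J' where J': "J' 1 = J 1" "\<And>j. J' j \<in> {0, J 1}" "excess_cost \<alpha> K J' \<le> excess_cost \<alpha> K J"
    using excess_cost_two_valued[OF K \<alpha>] by blast
  define x where "x j = (if J' j = J 1 then x1 else x0)" for j
  have "(\<lambda>j. enn2real (I (x j))) = J'"
    using J'(2) x0 x1(1) by (auto simp: x_def fun_eq_iff)
  then show ?thesis
    using J'(1,3) J(1) x0 x1 by (intro that[of x]) (auto simp: x_def)
qed

section \<open>Pointwise bounds for the weights and the estimator\<close>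

lemma neg_exp_nonneg [simp]: "0 \<le> neg_exp a"
  by (simp add: neg_exp_def)

lemma INS_weight_nonneg: "0 \<le> INS_weight I K \<alpha> \<epsilon> x"
  by (simp add: INS_weight_def sum_nonneg)

lemma INS_weight_le_1: "INS_weight I K \<alpha> \<epsilon> x \<le> 1"
proof -
  let ?d = "\<Sum>\<tau> | \<tau> permutes {1..K}. neg_exp (INS_exponent I K \<alpha> \<epsilon> (\<lambda>j. x (\<tau> j)))"
  have "neg_exp (INS_exponent I K \<alpha> \<epsilon> (\<lambda>j. x (id j))) \<le> ?d"
    by (rule member_le_sum[where i = id and f = "\<lambda>\<tau>. neg_exp (INS_exponent I K \<alpha> \<epsilon> (\<lambda>j. x (\<tau> j)))"])
      (auto intro: finite_permutations permutes_id)
  then have "neg_exp (INS_exponent I K \<alpha> \<epsilon> x) \<le> ?d" by simp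
  moreover have "0 \<le> ?d" by (intro sum_nonneg) simp
  ultimately show ?thesis
    unfolding INS_weight_def by (intro divide_le_eq_1[THEN iffD2]) linarith
qed

lemma INS_weight_eq_0:
  assumes "0 < \<epsilon>" "j \<in> {1..K}" "0 < \<alpha> j" "I (x j) = \<infinity>"
  shows "INS_weight I K \<alpha> \<epsilon> x = 0"
proof -
  have "ennreal (\<alpha> j) * I (x j) = \<infinity>" using assms by (simp add: ennreal_mult_top)
  then have "INS_exponent I K \<alpha> \<epsilon> x = \<infinity>"
    using assms(1,2) by (auto simp: INS_exponent_def ennreal_mult_eq_top_iff)
  then show ?thesis by (simp add: INS_weight_def neg_exp_def)
qed

lemma neg_exp_INS_exponent:
  assumes "0 < \<epsilon>" "\<And>j. j \<in> {1..K} \<Longrightarrow> 0 \<le> \<alpha> j" "\<And>j. j \<in> {1..K} \<Longrightarrow> I (x j) < \<infinity>"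
  shows "neg_exp (INS_exponent I K \<alpha> \<epsilon> x) = exp (- (\<Sum>j=1..K. \<alpha> j * enn2real (I (x j))) / \<epsilon>)"
proof -
  have "ennreal (\<alpha> j) * I (x j) = ennreal (\<alpha> j * enn2real (I (x j)))" if "j \<in> {1..K}" for j
    using assms(2,3)[OF that] by (simp add: ennreal_mult)
  then have "(\<Sum>j=1..K. ennreal (\<alpha> j) * I (x j)) = (\<Sum>j=1..K. ennreal (\<alpha> j * enn2real (I (x j))))"
    by (intro sum.cong) auto
  also have "\<dots> = ennreal (\<Sum>j=1..K. \<alpha> j * enn2real (I (x j)))"
    using assms(2) by (intro sum_ennreal) auto
  finally have sum: "(\<Sum>j=1..K. ennreal (\<alpha> j) * I (x j)) = ennreal (\<Sum>j=1..K. \<alpha> j * enn2real (I (x j)))" .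
  have "INS_exponent I K \<alpha> \<epsilon> x = ennreal ((\<Sum>j=1..K. \<alpha> j * enn2real (I (x j))) / \<epsilon>)"
    unfolding INS_exponent_def sum using assms(1,2)
    by (subst ennreal_mult[symmetric]) (auto intro!: sum_nonneg)
  moreover have "0 \<le> (\<Sum>j=1..K. \<alpha> j * enn2real (I (x j))) / \<epsilon>"
    using assms(1,2) by (intro divide_nonneg_pos sum_nonneg) auto
  ultimately show ?thesis by (simp add: neg_exp_def)
qed

text \<open>The denominator sums over all permutations, hence does not change when the point is
  rearranged by \<open>\<sigma>\<close>. Each of its \<open>fact K\<close> terms is at most
  \<open>exp (- min_cost \<alpha> K J / \<epsilon>)\<close> and one term equals this value, so the
  denominator is known up to the factor \<open>fact K\<close>.\<close>

lemma INS_weight_bounds: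
  assumes "0 < \<epsilon>" "\<And>j. j \<in> {1..K} \<Longrightarrow> 0 \<le> \<alpha> j" "\<And>j. j \<in> {1..K} \<Longrightarrow> I (x j) < \<infinity>"
    and \<sigma>: "\<sigma> permutes {1..K}"
  defines "J \<equiv> \<lambda>j. enn2real (I (x j))"
  shows "exp (- (perm_cost \<alpha> K J \<sigma> - min_cost \<alpha> K J) / \<epsilon>) / fact K
      \<le> INS_weight I K \<alpha> \<epsilon> (\<lambda>j. x (\<sigma> j))" (is "?low")
    and "INS_weight I K \<alpha> \<epsilon> (\<lambda>j. x (\<sigma> j))
      \<le> exp (- (perm_cost \<alpha> K J \<sigma> - min_cost \<alpha> K J) / \<epsilon>)" (is "?up")
proof -
  let ?P = "{\<tau>. \<tau> permutes {1..K}}"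
  define e where "e \<tau> = exp (- perm_cost \<alpha> K J \<tau> / \<epsilon>)" for \<tau>
  define m where "m = exp (- min_cost \<alpha> K J / \<epsilon>)"
  define d where "d = sum e ?P"
  have fin: "finite ?P" by (rule finite_permutations) simp
  have ne: "neg_exp (INS_exponent I K \<alpha> \<epsilon> (\<lambda>j. x (\<tau> j))) = e \<tau>" if "\<tau> permutes {1..K}" for \<tau>
    unfolding e_def perm_cost_def J_def
    using assms(1-3) permutes_in_image[OF that] by (subst neg_exp_INS_exponent) auto
  have "(\<Sum>\<tau>\<in>?P. neg_exp (INS_exponent I K \<alpha> \<epsilon> (\<lambda>j. x (\<sigma> (\<tau> j))))) = (\<Sum>\<tau>\<in>?P. e (\<sigma> \<circ> \<tau>))"
    using ne[OF permutes_compose[OF _ \<sigma>]] by (intro sum.cong) (auto simp: o_def)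
  also have "\<dots> = d"
    unfolding d_def by (rule setum_permutations_compose_left[OF \<sigma>, symmetric])
  finally have w: "INS_weight I K \<alpha> \<epsilon> (\<lambda>j. x (\<sigma> j)) = e \<sigma> / d"
    by (simp add: INS_weight_def ne[OF \<sigma>])
  have e_le: "e \<tau> \<le> m" if "\<tau> permutes {1..K}" for \<tau>
    unfolding e_def m_def using min_cost_le[OF that, of \<alpha> J] assms(1) by (simp add: divide_right_mono)
  have "d \<le> of_nat (card ?P) * m"
    unfolding d_def using e_le by (intro sum_bounded_above) auto
  also have "card ?P = fact K" by (rule card_permutations) auto
  finally have d_le: "d \<le> fact K * m" by simp
  obtain \<pi> where \<pi>: "\<pi> permutes {1..K}" "min_cost \<alpha> K J = perm_cost \<alpha> K J \<pi>"
    using min_cost_attained .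
  have "e \<pi> \<le> d" unfolding d_def
    using \<pi>(1) fin by (intro member_le_sum) (auto simp: e_def)
  then have m_le: "m \<le> d" by (simp add: m_def e_def \<pi>(2))
  have pos: "0 < m" "0 < e \<sigma>" by (auto simp: m_def e_def)
  have r: "exp (- (perm_cost \<alpha> K J \<sigma> - min_cost \<alpha> K J) / \<epsilon>) = e \<sigma> / m"
    by (simp add: e_def m_def exp_diff[symmetric] diff_divide_distrib)
  show ?low unfolding r w using pos d_le m_le
    by (simp add: mult.commute frac_le)
  show ?up unfolding r w using pos m_le by (intro divide_left_mono) auto
qed

lemma INS_estimator_nonneg: "0 \<le> INS_estimator I F K \<alpha> \<epsilon> x"
  by (simp add: INS_estimator_def INS_weight_nonneg sum_nonneg)

lemma sum_permutations_bounded: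
  fixes f :: "(nat \<Rightarrow> nat) \<Rightarrow> real"
  assumes "\<And>\<sigma>. \<sigma> permutes {1..K} \<Longrightarrow> f \<sigma> \<le> b"
  shows "(\<Sum>\<sigma> | \<sigma> permutes {1..K}. f \<sigma>) \<le> fact K * b"
proof -
  have "(\<Sum>\<sigma> | \<sigma> permutes {1..K}. f \<sigma>) \<le> of_nat (card {\<sigma>. \<sigma> permutes {1..K}}) * b"
    using assms by (intro sum_bounded_above) auto
  then show ?thesis by (simp add: card_permutations[where n = K])
qed

text \<open>Every weight is at most 1. This crude bound covers infinite rates too; it serves for
  square integrability and for the region where some rate is large.\<close>

lemma INS_estimator_le:
  assumes "0 < \<epsilon>" "\<And>x. - B \<le> F x"
  shows "INS_estimator I F K \<alpha> \<epsilon> x \<le> fact K * exp (B / \<epsilon>)"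
  unfolding INS_estimator_def
proof (rule sum_permutations_bounded)
  fix \<sigma> :: "nat \<Rightarrow> nat"
  have "exp (- (1 / \<epsilon>) * F (x (\<sigma> 1))) \<le> exp (B / \<epsilon>)"
    using assms divide_right_mono[of "- F (x (\<sigma> 1))" B \<epsilon>] by (simp add: minus_le_iff)
  then have "INS_weight I K \<alpha> \<epsilon> (\<lambda>j. x (\<sigma> j)) * exp (- (1 / \<epsilon>) * F (x (\<sigma> 1))) \<le> 1 * exp (B / \<epsilon>)"
    by (intro mult_mono INS_weight_le_1) auto
  then show "INS_weight I K \<alpha> \<epsilon> (\<lambda>j. x (\<sigma> j)) * exp (- (1 / \<epsilon>) * F (x (\<sigma> 1))) \<le> exp (B / \<epsilon>)" by simp
qed

text \<open>Whatever the permutation, the coordinate of infinite rate meets a positive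
  \<open>\<alpha>\<close>, so every weight has numerator 0.\<close>

lemma INS_estimator_eq_0:
  assumes "0 < \<epsilon>" "\<And>j. j \<in> {1..K} \<Longrightarrow> 0 < \<alpha> j" "j \<in> {1..K}" "I (x j) = \<infinity>"
  shows "INS_estimator I F K \<alpha> \<epsilon> x = 0"
proof -
  have "INS_weight I K \<alpha> \<epsilon> (\<lambda>j. x (\<sigma> j)) = 0" if \<sigma>: "\<sigma> permutes {1..K}" for \<sigma>
  proof (rule INS_weight_eq_0)
    show "inv \<sigma> j \<in> {1..K}" using permutes_in_image[OF permutes_inv[OF \<sigma>]] assms(3) by simp
    then show "0 < \<alpha> (inv \<sigma> j)" by (rule assms(2))
    show "I (x (\<sigma> (inv \<sigma> j))) = \<infinity>" using assms(4) by (simp add: permutes_inverses[OF \<sigma>])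
  qed (rule assms(1))
  then show ?thesis by (simp add: INS_estimator_def)
qed

text \<open>Apply the variational bound to the rearranged rates, one permutation at a time. With
  \<open>P\<close> the cost of \<open>\<sigma>\<close> and \<open>M\<close> the minimal cost it
  reads \<open>V \<le> 2 * (P - M + F) + M\<close>. Replacing the last \<open>M\<close> by the
  larger sum of the \<open>\<alpha> j * J j\<close> leaves an error that factorizes over the
  coordinates. Squaring will undo the 2 in the denominator.\<close>

lemma INS_estimator_le_V_F:
  assumes \<epsilon>: "0 < \<epsilon>" and K: "1 \<le> K"
    and \<alpha>: "antimono_on {1..K} \<alpha>" "\<And>j. j \<in> {1..K} \<Longrightarrow> 0 \<le> \<alpha> j"
    and F: "bdd_below (range F)" and fin: "\<And>j. j \<in> {1..K} \<Longrightarrow> I (x j) < \<infinity>"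
  defines "J \<equiv> \<lambda>j. enn2real (I (x j))"
  shows "INS_estimator I F K \<alpha> \<epsilon> x \<le> fact K * exp (((\<Sum>j=1..K. \<alpha> j * J j) - V_F I F K \<alpha>) / (2 * \<epsilon>))"
  unfolding INS_estimator_def
proof (rule sum_permutations_bounded)
  fix \<sigma> assume \<sigma>: "\<sigma> permutes {1..K}"
  have im: "\<sigma> j \<in> {1..K} \<longleftrightarrow> j \<in> {1..K}" for j by (rule permutes_in_image[OF \<sigma>])
  have "V_F I F K \<alpha> \<le> excess_cost \<alpha> K (\<lambda>j. J (\<sigma> j)) + 2 * F (x (\<sigma> 1))"
  proof (rule V_F_le_excess_cost[OF K \<alpha> F])
    have "I (x (\<sigma> 1)) < \<infinity>" using im[of 1] K fin by auto
    then show "(J (\<sigma> 1), F (x (\<sigma> 1))) \<in> finite_rate_pairs I F"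
      unfolding finite_rate_pairs_def J_def by blast
  qed (auto simp: J_def)
  also have "excess_cost \<alpha> K (\<lambda>j. J (\<sigma> j)) = 2 * perm_cost \<alpha> K J \<sigma> - min_cost \<alpha> K J"
    unfolding excess_cost_def min_cost_permute[OF \<sigma>] by (simp add: perm_cost_def)
  finally have "V_F I F K \<alpha> - (\<Sum>j=1..K. \<alpha> j * J j)
      \<le> 2 * (perm_cost \<alpha> K J \<sigma> - min_cost \<alpha> K J + F (x (\<sigma> 1)))"
    using min_cost_le_sum[of \<alpha> K J] by simp
  moreover define A where "A = perm_cost \<alpha> K J \<sigma> - min_cost \<alpha> K J + F (x (\<sigma> 1))"
  ultimately have "(2 * - A) / (2 * \<epsilon>) \<le> ((\<Sum>j=1..K. \<alpha> j * J j) - V_F I F K \<alpha>) / (2 * \<epsilon>)"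
    using \<epsilon> by (intro divide_right_mono) auto
  then have *: "- A / \<epsilon> \<le> ((\<Sum>j=1..K. \<alpha> j * J j) - V_F I F K \<alpha>) / (2 * \<epsilon>)"
    using \<epsilon> by simp
  have "INS_weight I K \<alpha> \<epsilon> (\<lambda>j. x (\<sigma> j)) * exp (- (1 / \<epsilon>) * F (x (\<sigma> 1)))
      \<le> exp (- (perm_cost \<alpha> K J \<sigma> - min_cost \<alpha> K J) / \<epsilon>) * exp (- (1 / \<epsilon>) * F (x (\<sigma> 1)))"
    unfolding J_def using INS_weight_bounds(2)[where x = x and I = I and \<alpha> = \<alpha>, OF \<epsilon> \<alpha>(2) fin \<sigma>] by (intro mult_right_mono) auto
  also have "\<dots> = exp (- (perm_cost \<alpha> K J \<sigma> - min_cost \<alpha> K J + F (x (\<sigma> 1))) / \<epsilon>)"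
    by (simp add: exp_add[symmetric] diff_divide_distrib add_divide_distrib)
  also have "\<dots> \<le> exp (((\<Sum>j=1..K. \<alpha> j * J j) - V_F I F K \<alpha>) / (2 * \<epsilon>))"
    using * by (simp add: A_def)
  finally show "INS_weight I K \<alpha> \<epsilon> (\<lambda>j. x (\<sigma> j)) * exp (- (1 / \<epsilon>) * F (x (\<sigma> 1)))
      \<le> exp (((\<Sum>j=1..K. \<alpha> j * J j) - V_F I F K \<alpha>) / (2 * \<epsilon>))" .
qed

lemma INS_estimator_ge:
  assumes \<epsilon>: "0 < \<epsilon>" and \<alpha>: "\<And>j. j \<in> {1..K} \<Longrightarrow> 0 \<le> \<alpha> j"
    and fin: "\<And>j. j \<in> {1..K} \<Longrightarrow> I (x j) < \<infinity>" and \<sigma>: "\<sigma> permutes {1..K}"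
  defines "J \<equiv> \<lambda>j. enn2real (I (x j))"
  shows "exp (- (perm_cost \<alpha> K J \<sigma> - min_cost \<alpha> K J + F (x (\<sigma> 1))) / \<epsilon>) / fact K
    \<le> INS_estimator I F K \<alpha> \<epsilon> x"
proof -
  have "exp (- (perm_cost \<alpha> K J \<sigma> - min_cost \<alpha> K J + F (x (\<sigma> 1))) / \<epsilon>) / fact K
      = exp (- (perm_cost \<alpha> K J \<sigma> - min_cost \<alpha> K J) / \<epsilon>) / fact K * exp (- (1 / \<epsilon>) * F (x (\<sigma> 1)))"
    by (simp add: exp_add[symmetric] diff_divide_distrib add_divide_distrib)
  also have "\<dots> \<le> INS_weight I K \<alpha> \<epsilon> (\<lambda>j. x (\<sigma> j)) * exp (- (1 / \<epsilon>) * F (x (\<sigma> 1)))"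
    unfolding J_def using INS_weight_bounds(1)[where x = x and I = I and \<alpha> = \<alpha>, OF \<epsilon> \<alpha> fin \<sigma>] by (intro mult_right_mono) auto
  also have "\<dots> \<le> INS_estimator I F K \<alpha> \<epsilon> x"
    unfolding INS_estimator_def using \<sigma>
    by (intro member_le_sum[where f = "\<lambda>\<sigma>. INS_weight I K \<alpha> \<epsilon> (\<lambda>j. x (\<sigma> j)) * exp (- (1 / \<epsilon>) * F (x (\<sigma> 1)))"])
      (auto simp: INS_weight_nonneg finite_permutations)
  finally show ?thesis .
qed

section \<open>Rate functions and large deviation bounds in exponential form\<close>

text \<open>Compact sublevel sets are closed in a Hausdorff space.\<close>

lemma rate_function_borel_measurable:
  fixes I :: "'a::t2_space \<Rightarrow> ennreal"
  assumes "rate_function I"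
  shows "I \<in> borel_measurable borel"
proof (rule borel_measurableI_le)
  fix y :: ennreal
  show "{x \<in> space borel. I x \<le> y} \<in> sets borel"
  proof (cases "y = \<infinity>")
    case False
    then have "closed {x. I x \<le> y}"
      using assms by (intro compact_imp_closed) (simp add: rate_function_def less_top)
    then show ?thesis by simp
  qed simp
qed

text \<open>The upper bound on the whole space, which has probability 1, forces the infimum of
  \<open>I\<close> to be 0. It is attained because \<open>I\<close> is continuous on the compact set
  of points of rate at most 1 and exceeds 1 elsewhere.\<close>

lemma satisfies_LDP_rate_zero:
  fixes I :: "'a::t2_space \<Rightarrow> ennreal"
  assumes I: "rate_function I" "continuous_on {x. I x < \<infinity>} I" and LDP: "satisfies_LDP \<mu> I"
    and prob: "\<And>\<epsilon>. \<epsilon> > 0 \<Longrightarrow> measure (\<mu> \<epsilon>) UNIV = 1"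
  obtains x where "I x = 0"
proof -
  have "Limsup (at_right 0) (\<lambda>\<epsilon>. ereal \<epsilon> * ln_ereal (measure (\<mu> \<epsilon>) UNIV)) \<le> - enn2ereal (INF x. I x)"
    using LDP unfolding satisfies_LDP_def by auto
  moreover have "Limsup (at_right 0) (\<lambda>\<epsilon>. ereal \<epsilon> * ln_ereal (measure (\<mu> \<epsilon>) UNIV))
      = Limsup (at_right 0) (\<lambda>\<epsilon>::real. 0::ereal)"
    by (intro Limsup_eq eventually_mono[OF eventually_at_right_less[of 0]])
      (simp add: prob ln_ereal_def)
  ultimately have "0 \<le> - enn2ereal (INF x. I x)" by (simp add: Limsup_const)
  then have "enn2ereal (INF x. I x) \<le> enn2ereal 0"
    by (simp only: ereal_0_le_uminus_iff zero_ennreal.rep_eq)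
  then have inf: "(INF x. I x) = 0"
    by (simp only: less_eq_ennreal.rep_eq[symmetric] le_zero_eq)
  define S where "S = {x. I x \<le> 1}"
  have "(INF x. I x) < 1" by (simp add: inf)
  then obtain x1 where "x1 \<in> S" unfolding S_def INF_less_iff by (auto intro: less_imp_le)
  moreover have "compact S" using I(1) by (simp add: S_def rate_function_def)
  moreover have "continuous_on S I"
    using I(2) by (rule continuous_on_subset) (auto simp: S_def intro: le_less_trans)
  ultimately obtain x where x: "x \<in> S" "\<And>y. y \<in> S \<Longrightarrow> I x \<le> I y"
    using continuous_attains_inf[of S I] by blast
  have "I x \<le> I y" for y
    using x(2)[of y] x(1) by (cases "y \<in> S") (auto simp: S_def)
  then have "I x \<le> (INF y. I y)" by (intro INF_greatest)
  with inf show ?thesis by (intro that[of x]) simp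
qed

text \<open>A loss \<open>\<eta>\<close> in the exponent turns the upper limit of logarithms into a
  bound on the probability itself for all small \<open>\<epsilon>\<close>.\<close>

lemma satisfies_LDP_closed:
  assumes LDP: "satisfies_LDP \<mu> I" and "closed C"
    and C: "\<And>x. x \<in> C \<Longrightarrow> ennreal a \<le> I x" and "0 \<le> a" "0 < \<eta>"
  shows "eventually (\<lambda>\<epsilon>. measure (\<mu> \<epsilon>) C \<le> exp (- (a - \<eta>) / \<epsilon>)) (at_right 0)"
proof -
  have "Limsup (at_right 0) (\<lambda>\<epsilon>. ereal \<epsilon> * ln_ereal (measure (\<mu> \<epsilon>) C)) \<le> - enn2ereal (INF x\<in>C. I x)"
    using LDP \<open>closed C\<close> unfolding satisfies_LDP_def by auto
  also have "\<dots> \<le> - ereal a"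
  proof -
    have "ennreal a \<le> (INF x\<in>C. I x)" using C by (intro INF_greatest)
    then have "enn2ereal (ennreal a) \<le> enn2ereal (INF x\<in>C. I x)" by (simp add: less_eq_ennreal.rep_eq)
    then show ?thesis using \<open>0 \<le> a\<close> by (simp only: ereal_minus_le_minus enn2ereal_ennreal)
  qed
  also have "\<dots> < ereal (- (a - \<eta>))" using \<open>0 < \<eta>\<close> by simp
  finally have "eventually (\<lambda>\<epsilon>. ereal \<epsilon> * ln_ereal (measure (\<mu> \<epsilon>) C) < ereal (- (a - \<eta>))) (at_right 0)"
    by (rule Limsup_lessD)
  then show ?thesis
  proof (rule eventually_rev_mp[OF _ eventually_mono[OF eventually_at_right_less[of 0]]], intro impI)
    fix \<epsilon> :: real
    assume \<epsilon>: "0 < \<epsilon>" and less: "ereal \<epsilon> * ln_ereal (measure (\<mu> \<epsilon>) C) < ereal (- (a - \<eta>))"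
    \<comment> \<open>Probability 0 is treated apart, as the real \<open>ln 0\<close> is 0; the
      bound is then trivial.\<close>
    show "measure (\<mu> \<epsilon>) C \<le> exp (- (a - \<eta>) / \<epsilon>)"
    proof (cases "measure (\<mu> \<epsilon>) C = 0")
      case False
      then have "\<epsilon> * ln (measure (\<mu> \<epsilon>) C) < - (a - \<eta>)" using less by (simp add: ln_ereal_def)
      then have "ln (measure (\<mu> \<epsilon>) C) \<le> - (a - \<eta>) / \<epsilon>" using \<epsilon> by (simp add: field_simps)
      moreover have "0 < measure (\<mu> \<epsilon>) C" using False by (simp add: zero_less_measure_iff)
      ultimately show ?thesis by (metis exp_le_cancel_iff exp_ln)
    qed simp
  qed
qed

text \<open>The single point \<open>y\<close> bounds the infimum over \<open>U\<close> from above,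
  and a loss \<open>\<eta>\<close> again removes the limit and the logarithm.\<close>

lemma satisfies_LDP_open:
  assumes LDP: "satisfies_LDP \<mu> I" and "open U" "y \<in> U" "I y < \<infinity>" "0 < \<eta>"
  shows "eventually (\<lambda>\<epsilon>. exp (- (enn2real (I y) + \<eta>) / \<epsilon>) \<le> measure (\<mu> \<epsilon>) U) (at_right 0)"
proof -
  define a where "a = enn2real (I y)"
  have a: "I y = ennreal a" "0 \<le> a" using assms(4) by (auto simp: a_def)
  have "ereal (- (a + \<eta>)) < - ereal a" using \<open>0 < \<eta>\<close> by simp
  also have "\<dots> \<le> - enn2ereal (INF x\<in>U. I x)"
  proof -
    have "(INF x\<in>U. I x) \<le> ennreal a" using INF_lower[OF \<open>y \<in> U\<close>, of I] a(1) by simp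
    then have "enn2ereal (INF x\<in>U. I x) \<le> enn2ereal (ennreal a)" by (simp add: less_eq_ennreal.rep_eq)
    then show ?thesis using \<open>0 \<le> a\<close> by (simp only: ereal_minus_le_minus enn2ereal_ennreal)
  qed
  also have "\<dots> \<le> Liminf (at_right 0) (\<lambda>\<epsilon>. ereal \<epsilon> * ln_ereal (measure (\<mu> \<epsilon>) U))"
    using LDP \<open>open U\<close> unfolding satisfies_LDP_def by auto
  finally have "eventually (\<lambda>\<epsilon>. ereal (- (a + \<eta>)) < ereal \<epsilon> * ln_ereal (measure (\<mu> \<epsilon>) U)) (at_right 0)"
    by (rule less_LiminfD)
  then show ?thesis unfolding a_def[symmetric]
  proof (rule eventually_rev_mp[OF _ eventually_mono[OF eventually_at_right_less[of 0]]], intro impI)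
    fix \<epsilon> :: real
    assume \<epsilon>: "0 < \<epsilon>" and less: "ereal (- (a + \<eta>)) < ereal \<epsilon> * ln_ereal (measure (\<mu> \<epsilon>) U)"
    show "exp (- (a + \<eta>) / \<epsilon>) \<le> measure (\<mu> \<epsilon>) U"
    proof (cases "measure (\<mu> \<epsilon>) U = 0")
      case True
      \<comment> \<open>Here \<open>ln_ereal\<close> is minus infinity, which contradicts the strict
        inequality.\<close>
      then show ?thesis using less \<epsilon> by (simp add: ln_ereal_def)
    next
      case False
      then have "- (a + \<eta>) < \<epsilon> * ln (measure (\<mu> \<epsilon>) U)" using less by (simp add: ln_ereal_def)
      then have "- (a + \<eta>) / \<epsilon> \<le> ln (measure (\<mu> \<epsilon>) U)" using \<epsilon> by (simp add: field_simps)
      moreover have "0 < measure (\<mu> \<epsilon>) U" using False by (simp add: zero_less_measure_iff)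
      ultimately show ?thesis by (metis exp_le_cancel_iff exp_ln)
    qed
  qed
qed

text \<open>The closure of \<open>{x. a \<le> I x \<and> I x < \<infinity>}\<close> may well contain points of infinite rate,
  but continuity on the domain of finiteness excludes points of rate below \<open>a\<close>.\<close>

lemma satisfies_LDP_finite_rate_ge:
  fixes I :: "'a::t2_space \<Rightarrow> ennreal"
  assumes I: "rate_function I" "continuous_on {x. I x < \<infinity>} I" and LDP: "satisfies_LDP \<mu> I"
    and \<mu>: "\<And>\<epsilon>. \<epsilon> > 0 \<Longrightarrow> finite_measure (\<mu> \<epsilon>)" "\<And>\<epsilon>. \<epsilon> > 0 \<Longrightarrow> sets (\<mu> \<epsilon>) = sets borel"
    and "0 \<le> a" "0 < \<eta>"
  shows "eventually (\<lambda>\<epsilon>. measure (\<mu> \<epsilon>) {x. ennreal a \<le> I x \<and> I x < \<infinity>} \<le> exp (- (a - \<eta>) / \<epsilon>))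
    (at_right 0)"
proof -
  \<comment> \<open>By continuity the set is relatively closed in the domain of finiteness.
    \<open>C\<close> is closed in the whole space with the same trace, and its remaining points have
    infinite rate.\<close>
  obtain C where C: "closed C" "{x. I x < \<infinity>} \<inter> I -` {ennreal a..} = {x. I x < \<infinity>} \<inter> C"
    using continuous_closedin_preimage[OF I(2), of "{ennreal a..}"] by (auto simp: closedin_closed)
  have "ennreal a \<le> I x" if "x \<in> C" for x
    using C(2) that by (cases "I x < \<infinity>") (auto simp: less_top[symmetric])
  then have "eventually (\<lambda>\<epsilon>. measure (\<mu> \<epsilon>) C \<le> exp (- (a - \<eta>) / \<epsilon>)) (at_right 0)"
    by (intro satisfies_LDP_closed[OF LDP C(1)] assms)
  then show ?thesis
  proof (rule eventually_rev_mp[OF _ eventually_mono[OF eventually_at_right_less[of 0]]], intro impI)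
    fix \<epsilon> :: real
    assume \<epsilon>: "0 < \<epsilon>" and le: "measure (\<mu> \<epsilon>) C \<le> exp (- (a - \<eta>) / \<epsilon>)"
    have "measure (\<mu> \<epsilon>) {x. ennreal a \<le> I x \<and> I x < \<infinity>} \<le> measure (\<mu> \<epsilon>) C"
      using C \<mu>[OF \<epsilon>] by (intro finite_measure.finite_measure_mono) auto
    with le show "measure (\<mu> \<epsilon>) {x. ennreal a \<le> I x \<and> I x < \<infinity>} \<le> exp (- (a - \<eta>) / \<epsilon>)" by simp
  qed
qed

text \<open>Transfers estimates for \<open>\<mu> \<epsilon>\<close> to the law of a coordinate,
  whose parameter is \<open>\<epsilon> / \<alpha> j\<close>.\<close>

lemma eventually_at_right_0_divide:
  fixes a :: real
  assumes "eventually P (at_right 0)" "0 < a"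
  shows "eventually (\<lambda>\<epsilon>. P (\<epsilon> / a)) (at_right 0)"
proof -
  obtain b where b: "0 < b" "\<And>y. 0 < y \<Longrightarrow> y < b \<Longrightarrow> P y"
    using assms(1) by (auto simp: eventually_at_right_field)
  then show ?thesis using assms(2)
    unfolding eventually_at_right_field
    by (intro exI[of _ "b * a"]) (auto simp: field_simps)
qed

section \<open>Points of infinite rate and measurability of the estimator\<close>

text \<open>The density has the factor \<open>neg_exp \<infinity> = 0\<close>. Hence open sets lose
  no probability when cut down to points of finite rate.\<close>

lemma gibbs_measure_infinite_rate:
  assumes "I \<in> borel_measurable \<gamma>" "0 < \<epsilon>"
  shows "measure (gibbs_measure \<gamma> I \<epsilon>) {x \<in> space \<gamma>. I x = \<infinity>} = 0"
proof -
  have [measurable]: "(\<lambda>x. neg_exp (ennreal (1 / \<epsilon>) * I x)) \<in> borel_measurable \<gamma>"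
    using assms(1) unfolding neg_exp_def by measurable
  have [measurable]: "{x \<in> space \<gamma>. I x = \<infinity>} \<in> sets \<gamma>" using assms(1) by measurable
  have "emeasure (gibbs_measure \<gamma> I \<epsilon>) {x \<in> space \<gamma>. I x = \<infinity>} =
      (\<integral>\<^sup>+ x. ennreal (neg_exp (ennreal (1 / \<epsilon>) * I x)) / gibbs_Z \<gamma> I \<epsilon>
        * indicator {x \<in> space \<gamma>. I x = \<infinity>} x \<partial>\<gamma>)"
    unfolding gibbs_measure_def by (intro emeasure_density) measurable
  also have "\<dots> = (\<integral>\<^sup>+ x. 0 \<partial>\<gamma>)"
    using assms(2) by (intro nn_integral_cong) (auto simp: indicator_def ennreal_mult_top neg_exp_def)
  finally show ?thesis by (simp add: measure_def)
qed

text \<open>Measurability is given for the coordinates in \<open>{1..K}\<close>, so the argument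
  rests on permutations keeping indices in this range.\<close>

lemma INS_estimator_measurable:
  assumes I: "I \<in> borel_measurable borel" and F: "F \<in> borel_measurable borel"
    and X: "\<And>j. j \<in> {1..K} \<Longrightarrow> X j \<in> measurable M borel" and K: "1 \<le> K"
  shows "(\<lambda>\<omega>. INS_estimator I F K \<alpha> \<epsilon> (\<lambda>j. X j \<omega>)) \<in> borel_measurable M"
proof -
  note [measurable] = F
  have neg: "neg_exp \<in> borel_measurable borel"
    unfolding neg_exp_def[abs_def] by measurable
  have e: "(\<lambda>\<omega>. neg_exp (INS_exponent I K \<alpha> \<epsilon> (\<lambda>j. X (\<sigma> j) \<omega>))) \<in> borel_measurable M"
    if \<sigma>: "\<And>j. j \<in> {1..K} \<Longrightarrow> \<sigma> j \<in> {1..K}" for \<sigma>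
  proof -
    have "(\<lambda>\<omega>. ennreal (\<alpha> j) * I (X (\<sigma> j) \<omega>)) \<in> borel_measurable M" if "j \<in> {1..K}" for j
      by (intro borel_measurable_times_ennreal borel_measurable_const measurable_compose[OF X I] that \<sigma>)
    then have sum: "(\<lambda>\<omega>. \<Sum>j=1..K. ennreal (\<alpha> j) * I (X (\<sigma> j) \<omega>)) \<in> borel_measurable M"
      by (rule borel_measurable_sum)
    show ?thesis unfolding INS_exponent_def
      by (intro measurable_compose[OF _ neg] borel_measurable_times_ennreal borel_measurable_const sum)
  qed
  have expF: "(\<lambda>x. exp (- (1 / \<epsilon>) * F x)) \<in> borel_measurable borel" by measurable
  show ?thesis
    unfolding INS_estimator_def INS_weight_def
  proof (rule borel_measurable_sum)
    fix \<sigma> assume "\<sigma> \<in> {\<sigma>. \<sigma> permutes {1..K}}"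
    then have \<sigma>: "\<sigma> j \<in> {1..K} \<longleftrightarrow> j \<in> {1..K}" for j using permutes_in_image[of \<sigma> "{1..K}" j] by simp
    have X1: "X (\<sigma> 1) \<in> measurable M borel" using \<sigma>[of 1] K by (intro X) simp
    have num: "(\<lambda>\<omega>. neg_exp (INS_exponent I K \<alpha> \<epsilon> (\<lambda>j. X (\<sigma> j) \<omega>))) \<in> borel_measurable M"
      by (rule e) (simp only: \<sigma>)
    have den: "(\<lambda>\<omega>. \<Sum>\<tau> | \<tau> permutes {1..K}.
        neg_exp (INS_exponent I K \<alpha> \<epsilon> (\<lambda>j. X (\<sigma> (\<tau> j)) \<omega>))) \<in> borel_measurable M"
    proof (rule borel_measurable_sum)
      fix \<tau> assume "\<tau> \<in> {\<tau>. \<tau> permutes {1..K}}"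
      then have \<tau>: "\<tau> j \<in> {1..K} \<longleftrightarrow> j \<in> {1..K}" for j using permutes_in_image[of \<tau> "{1..K}" j] by simp
      show "(\<lambda>\<omega>. neg_exp (INS_exponent I K \<alpha> \<epsilon> (\<lambda>j. X (\<sigma> (\<tau> j)) \<omega>))) \<in> borel_measurable M"
        by (rule e[where \<sigma> = "\<lambda>j. \<sigma> (\<tau> j)"]) (simp only: \<sigma> \<tau>)
    qed
    show "(\<lambda>\<omega>. neg_exp (INS_exponent I K \<alpha> \<epsilon> (\<lambda>j. X (\<sigma> j) \<omega>)) /
        (\<Sum>\<tau> | \<tau> permutes {1..K}. neg_exp (INS_exponent I K \<alpha> \<epsilon> (\<lambda>j. X (\<sigma> (\<tau> j)) \<omega>)))
        * exp (- (1 / \<epsilon>) * F (X (\<sigma> 1) \<omega>))) \<in> borel_measurable M"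
      by (rule borel_measurable_times[OF borel_measurable_divide[OF num den] measurable_compose[OF X1 expF]])
  qed
qed

section \<open>Upper bound for the second moment\<close>

text \<open>A stand-in for \<open>exp (enn2real (I x) / \<epsilon>)\<close> below the truncation
  level \<open>\<delta> * real n\<close>. It is carried by finitely many superlevel sets that do not
  depend on \<open>\<epsilon>\<close>, so the large deviation bound applies to all of them at once.
  The \<open>+ 1\<close> rounds the rate up to the mesh.\<close>

definition rate_tilt :: "('a \<Rightarrow> ennreal) \<Rightarrow> nat \<Rightarrow> real \<Rightarrow> real \<Rightarrow> 'a \<Rightarrow> real" where
  "rate_tilt I n \<delta> \<epsilon> x =
     (\<Sum>c<n. exp (\<delta> * (real c + 1) / \<epsilon>) * indicator {x. ennreal (\<delta> * real c) \<le> I x \<and> I x < \<infinity>} x)"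

lemma rate_tilt_nonneg: "0 \<le> rate_tilt I n \<delta> \<epsilon> x"
  by (auto simp: rate_tilt_def intro!: sum_nonneg)

lemma exp_le_rate_tilt:
  assumes "0 < \<epsilon>" "0 < \<delta>" "I x < ennreal (\<delta> * real n)"
  shows "exp (enn2real (I x) / \<epsilon>) \<le> rate_tilt I n \<delta> \<epsilon> x"
proof -
  define r where "r = enn2real (I x)"
  have fin: "I x < \<infinity>" using assms(3) by (metis ennreal_less_top infinity_ennreal_def less_trans)
  then have r: "I x = ennreal r" "0 \<le> r" by (auto simp: r_def)
  \<comment> \<open>The mesh cell containing \<open>r\<close>; its summand alone dominates.\<close>
  define c where "c = nat \<lfloor>r / \<delta>\<rfloor>"
  have "real c = of_int \<lfloor>r / \<delta>\<rfloor>" using assms(2) r(2) by (simp add: c_def)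
  then have "real c \<le> r / \<delta>" "r / \<delta> < real c + 1" by linarith+
  then have c: "\<delta> * real c \<le> r" "r < \<delta> * (real c + 1)"
    using assms(2) by (simp_all add: field_simps)
  have "r < \<delta> * real n" using assms(3) r by (simp add: ennreal_less_iff)
  with c(1) have "\<delta> * real c < \<delta> * real n" by linarith
  then have "c < n" using assms(2) by simp
  have "exp (r / \<epsilon>) \<le> exp (\<delta> * (real c + 1) / \<epsilon>) * indicator {x. ennreal (\<delta> * real c) \<le> I x \<and> I x < \<infinity>} x"
    using c fin r assms(1) by (simp add: ennreal_leI divide_right_mono)
  also have "\<dots> \<le> rate_tilt I n \<delta> \<epsilon> x"
    unfolding rate_tilt_def using \<open>c < n\<close>
    by (intro member_le_sum[where f = "\<lambda>c. exp (\<delta> * (real c + 1) / \<epsilon>)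
      * indicator {x. ennreal (\<delta> * real c) \<le> I x \<and> I x < \<infinity>} x"]) auto
  finally show ?thesis by (simp add: r_def)
qed

lemma rate_tilt_measurable [measurable]:
  assumes [measurable]: "I \<in> borel_measurable borel"
  shows "rate_tilt I n \<delta> \<epsilon> \<in> borel_measurable borel"
  unfolding rate_tilt_def by measurable

lemma rate_tilt_integrable:
  assumes [measurable]: "I \<in> borel_measurable borel"
    and M: "finite_measure M" "sets M = sets borel"
  shows "integrable M (rate_tilt I n \<delta> \<epsilon>)"
proof -
  interpret finite_measure M by fact
  have "{x. ennreal (\<delta> * real c) \<le> I x \<and> I x < \<infinity>} \<in> sets M" for c
    unfolding M(2) by measurable
  then show ?thesis
    unfolding rate_tilt_def[abs_def]
    by (intro Bochner_Integration.integrable_sum integrable_mult_right integrable_real_indicator)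
      (auto simp: emeasure_eq_measure)
qed

text \<open>In summand \<open>c\<close> the exponents \<open>\<delta> * real c\<close> cancel. What
  remains is one \<open>\<delta>\<close> from rounding up and one from the loss in the large
  deviation bound.\<close>

lemma rate_tilt_integral_le:
  fixes I :: "'a::t2_space \<Rightarrow> ennreal"
  assumes I: "rate_function I" "continuous_on {x. I x < \<infinity>} I" and LDP: "satisfies_LDP \<mu> I"
    and \<mu>: "\<And>\<epsilon>. \<epsilon> > 0 \<Longrightarrow> finite_measure (\<mu> \<epsilon>)" "\<And>\<epsilon>. \<epsilon> > 0 \<Longrightarrow> sets (\<mu> \<epsilon>) = sets borel"
    and "0 < \<delta>"
  shows "eventually (\<lambda>\<epsilon>. (\<integral>x. rate_tilt I n \<delta> \<epsilon> x \<partial>\<mu> \<epsilon>) \<le> real n * exp (2 * \<delta> / \<epsilon>)) (at_right 0)"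
proof -
  note [measurable] = rate_function_borel_measurable[OF I(1)]
  let ?A = "\<lambda>c. {x. ennreal (\<delta> * real c) \<le> I x \<and> I x < \<infinity>}"
  have "eventually (\<lambda>\<epsilon>. measure (\<mu> \<epsilon>) (?A c) \<le> exp (- (\<delta> * real c - \<delta>) / \<epsilon>)) (at_right 0)" for c
    using satisfies_LDP_finite_rate_ge[OF I LDP \<mu>] \<open>0 < \<delta>\<close> by simp
  then have "eventually (\<lambda>\<epsilon>. \<forall>c\<in>{..<n}. measure (\<mu> \<epsilon>) (?A c) \<le> exp (- (\<delta> * real c - \<delta>) / \<epsilon>)) (at_right 0)"
    by (intro eventually_ball_finite) auto
  then show ?thesis
  proof (rule eventually_rev_mp[OF _ eventually_mono[OF eventually_at_right_less[of 0]]], intro impI)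
    fix \<epsilon> :: real
    assume \<epsilon>: "0 < \<epsilon>"
      and le: "\<forall>c\<in>{..<n}. measure (\<mu> \<epsilon>) (?A c) \<le> exp (- (\<delta> * real c - \<delta>) / \<epsilon>)"
    interpret finite_measure "\<mu> \<epsilon>" using \<mu>(1)[OF \<epsilon>] .
    have A: "?A c \<in> sets (\<mu> \<epsilon>)" for c unfolding \<mu>(2)[OF \<epsilon>] by measurable
    have "(\<integral>x. rate_tilt I n \<delta> \<epsilon> x \<partial>\<mu> \<epsilon>) = (\<Sum>c<n. \<integral>x. exp (\<delta> * (real c + 1) / \<epsilon>) * indicator (?A c) x \<partial>\<mu> \<epsilon>)"
      unfolding rate_tilt_def
      by (intro Bochner_Integration.integral_sum integrable_mult_right integrable_real_indicator A)
        (simp add: emeasure_eq_measure)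
    also have "\<dots> = (\<Sum>c<n. exp (\<delta> * (real c + 1) / \<epsilon>) * measure (\<mu> \<epsilon>) (?A c))"
      using sets.sets_into_space[OF A] by (intro sum.cong refl) (simp add: Int_absorb2)
    also have "\<dots> \<le> of_nat (card {..<n}) * exp (2 * \<delta> / \<epsilon>)"
    proof (rule sum_bounded_above)
      fix c assume "c \<in> {..<n}"
      then have "exp (\<delta> * (real c + 1) / \<epsilon>) * measure (\<mu> \<epsilon>) (?A c)
          \<le> exp (\<delta> * (real c + 1) / \<epsilon>) * exp (- (\<delta> * real c - \<delta>) / \<epsilon>)"
        using le by (intro mult_left_mono) auto
      also have "\<dots> = exp (2 * \<delta> / \<epsilon>)"
      proof -
        have "\<delta> * (real c + 1) / \<epsilon> + - (\<delta> * real c - \<delta>) / \<epsilon> = (\<delta> * (real c + 1) + - (\<delta> * real c - \<delta>)) / \<epsilon>"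
          by (rule add_divide_distrib[symmetric])
        also have "\<delta> * (real c + 1) + - (\<delta> * real c - \<delta>) = 2 * \<delta>" by (simp add: algebra_simps)
        finally show ?thesis by (simp only: exp_add[symmetric])
      qed
      finally show "exp (\<delta> * (real c + 1) / \<epsilon>) * measure (\<mu> \<epsilon>) (?A c) \<le> exp (2 * \<delta> / \<epsilon>)" .
    qed
    finally show "(\<integral>x. rate_tilt I n \<delta> \<epsilon> x \<partial>\<mu> \<epsilon>) \<le> real n * exp (2 * \<delta> / \<epsilon>)" by simp
  qed
qed

text \<open>Three regions: an infinite rate makes the estimator vanish; a finite rate beyond the
  truncation level is covered by the crude bound and an indicator; otherwise the bound through
  \<open>V_F\<close> applies and its exponential splits into one tilt per coordinate. Both summands
  are nonnegative, so their sum covers all cases.\<close>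

lemma INS_estimator_square_le:
  assumes \<epsilon>: "0 < \<epsilon>" and \<delta>: "0 < \<delta>" and K: "1 \<le> K"
    and \<alpha>: "antimono_on {1..K} \<alpha>" "\<And>j. j \<in> {1..K} \<Longrightarrow> 0 < \<alpha> j"
    and F: "\<And>x. - B \<le> F x"
  shows "(INS_estimator I F K \<alpha> \<epsilon> x)\<^sup>2 \<le> (fact K)\<^sup>2 *
    (exp (- V_F I F K \<alpha> / \<epsilon>) * (\<Prod>j=1..K. rate_tilt I n \<delta> (\<epsilon> / \<alpha> j) (x j))
      + exp (2 * B / \<epsilon>) * (\<Sum>j=1..K. indicator {x. ennreal (\<delta> * real n) \<le> I x \<and> I x < \<infinity>} (x j)))"
    (is "_ \<le> _ * (?S + ?T)")
proof -
  have S: "0 \<le> ?S" by (intro mult_nonneg_nonneg prod_nonneg rate_tilt_nonneg ballI) simp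
  have T: "0 \<le> ?T" by (intro mult_nonneg_nonneg sum_nonneg) auto
  consider j where "j \<in> {1..K}" "I (x j) = \<infinity>"
    | j where "j \<in> {1..K}" "ennreal (\<delta> * real n) \<le> I (x j)" "I (x j) < \<infinity>"
    | "\<And>j. j \<in> {1..K} \<Longrightarrow> I (x j) < ennreal (\<delta> * real n)"
    by (metis not_le top.not_eq_extremum infinity_ennreal_def)
  then show ?thesis
  proof cases
    case 1
    then have "INS_estimator I F K \<alpha> \<epsilon> x = 0" using \<epsilon> \<alpha>(2) by (intro INS_estimator_eq_0)
    then show ?thesis using S T by simp
  next
    case 2
    have "(INS_estimator I F K \<alpha> \<epsilon> x)\<^sup>2 \<le> (fact K * exp (B / \<epsilon>))\<^sup>2"
      using INS_estimator_le[OF \<epsilon> F] INS_estimator_nonneg by (intro power_mono)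
    also have "\<dots> = (fact K)\<^sup>2 * (exp (2 * B / \<epsilon>) * 1)"
      by (simp add: power_mult_distrib exp_double[symmetric])
    also have "\<dots> \<le> (fact K)\<^sup>2 * ?T"
    proof (intro mult_left_mono)
      have "indicator {x. ennreal (\<delta> * real n) \<le> I x \<and> I x < \<infinity>} (x j)
          \<le> (\<Sum>j=1..K. indicator {x. ennreal (\<delta> * real n) \<le> I x \<and> I x < \<infinity>} (x j) :: real)"
        using 2 by (intro member_le_sum[where i = j]) auto
      then show "1 \<le> (\<Sum>j=1..K. indicator {x. ennreal (\<delta> * real n) \<le> I x \<and> I x < \<infinity>} (x j) :: real)"
        using 2 by simp
    qed auto
    also have "\<dots> \<le> (fact K)\<^sup>2 * (?S + ?T)" using S by (intro mult_left_mono) auto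
    finally show ?thesis .
  next
    case 3
    have half: "2 * (d / (2 * \<epsilon>)) = d / \<epsilon>" for d by simp
    define V where "V = V_F I F K \<alpha>"
    define J where "J j = enn2real (I (x j))" for j
    have fin: "I (x j) < \<infinity>" if "j \<in> {1..K}" for j
      using 3[OF that] by (metis ennreal_less_top infinity_ennreal_def less_trans)
    have "INS_estimator I F K \<alpha> \<epsilon> x \<le> fact K * exp (((\<Sum>j=1..K. \<alpha> j * J j) - V) / (2 * \<epsilon>))"
      unfolding V_def J_def using \<epsilon> K \<alpha> F fin
      by (intro INS_estimator_le_V_F) (auto simp: less_imp_le intro!: bdd_belowI2)
    then have "(INS_estimator I F K \<alpha> \<epsilon> x)\<^sup>2 \<le> (fact K * exp (((\<Sum>j=1..K. \<alpha> j * J j) - V) / (2 * \<epsilon>)))\<^sup>2"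
      using INS_estimator_nonneg by (intro power_mono)
    also have "\<dots> = (fact K)\<^sup>2 * exp (2 * (((\<Sum>j=1..K. \<alpha> j * J j) - V) / (2 * \<epsilon>)))"
      by (simp only: power_mult_distrib exp_double)
    also have "\<dots> = (fact K)\<^sup>2 * exp (((\<Sum>j=1..K. \<alpha> j * J j) - V) / \<epsilon>)"
      by (simp only: half)
    \<comment> \<open>Writing \<open>\<alpha> j * J j / \<epsilon>\<close> as
      \<open>J j / (\<epsilon> / \<alpha> j)\<close> tilts each coordinate at the temperature of its
      own law.\<close>
    also have "exp (((\<Sum>j=1..K. \<alpha> j * J j) - V) / \<epsilon>) = exp (- V / \<epsilon>) * (\<Prod>j=1..K. exp (J j / (\<epsilon> / \<alpha> j)))"
    proof -
      have "((\<Sum>j=1..K. \<alpha> j * J j) - V) / \<epsilon> = - V / \<epsilon> + (\<Sum>j=1..K. J j / (\<epsilon> / \<alpha> j))"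
        by (simp add: diff_divide_distrib sum_divide_distrib mult.commute)
      then show ?thesis by (simp only: exp_add exp_sum finite_atLeastAtMost)
    qed
    also have "(fact K)\<^sup>2 * \<dots> \<le> (fact K)\<^sup>2 * ?S"
    proof (intro mult_left_mono, fold V_def, intro mult_left_mono prod_mono conjI)
      fix j assume j: "j \<in> {1..K}"
      show "exp (J j / (\<epsilon> / \<alpha> j)) \<le> rate_tilt I n \<delta> (\<epsilon> / \<alpha> j) (x j)"
        unfolding J_def using \<epsilon> \<alpha>(2)[OF j] \<delta> 3[OF j] by (intro exp_le_rate_tilt) auto
    qed auto
    also have "\<dots> \<le> (fact K)\<^sup>2 * (?S + ?T)" using T by (intro mult_left_mono) auto
    finally show ?thesis .
  qed
qed

lemma (in prob_space) INS_estimator_square_integrable: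
  assumes "0 < \<epsilon>" and F: "\<And>x. - B \<le> F x"
    and "I \<in> borel_measurable borel" "F \<in> borel_measurable borel"
    and "\<And>j. j \<in> {1..K} \<Longrightarrow> X j \<in> measurable M borel" "1 \<le> K"
  shows "integrable M (\<lambda>\<omega>. (INS_estimator I F K \<alpha> \<epsilon> (\<lambda>j. X j \<omega>))\<^sup>2)"
proof (rule integrable_const_bound)
  have [measurable]: "(\<lambda>\<omega>. INS_estimator I F K \<alpha> \<epsilon> (\<lambda>j. X j \<omega>)) \<in> borel_measurable M"
    using assms(3-6) by (rule INS_estimator_measurable)
  show "(\<lambda>\<omega>. (INS_estimator I F K \<alpha> \<epsilon> (\<lambda>j. X j \<omega>))\<^sup>2) \<in> borel_measurable M" by measurable
  show "AE \<omega> in M. norm ((INS_estimator I F K \<alpha> \<epsilon> (\<lambda>j. X j \<omega>))\<^sup>2) \<le> (fact K * exp (B / \<epsilon>))\<^sup>2"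
  proof (rule AE_I2)
    fix \<omega>
    have "(INS_estimator I F K \<alpha> \<epsilon> (\<lambda>j. X j \<omega>))\<^sup>2 \<le> (fact K * exp (B / \<epsilon>))\<^sup>2"
      by (rule power_mono[OF INS_estimator_le[where F = F, OF assms(1) F] INS_estimator_nonneg])
    then show "norm ((INS_estimator I F K \<alpha> \<epsilon> (\<lambda>j. X j \<omega>))\<^sup>2) \<le> (fact K * exp (B / \<epsilon>))\<^sup>2"
      by simp
  qed
qed

text \<open>Take expectations in the pointwise bound. Independence factorizes the product of tilts,
  each at a small exponential cost, and the truncation level is set so high that the tail
  probabilities beat the growth of the crude bound.\<close>

lemma INS_second_moment_upper:
  fixes I :: "'a::t2_space \<Rightarrow> ennreal"
  assumes I: "rate_function I" "continuous_on {x. I x < \<infinity>} I" and LDP: "satisfies_LDP \<mu> I"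
    and \<mu>: "\<And>\<epsilon>. \<epsilon> > 0 \<Longrightarrow> finite_measure (\<mu> \<epsilon>)" "\<And>\<epsilon>. \<epsilon> > 0 \<Longrightarrow> sets (\<mu> \<epsilon>) = sets borel"
    and F: "F \<in> borel_measurable borel" "bdd_below (range F)"
    and K: "1 \<le> K" and \<alpha>: "antimono_on {1..K} \<alpha>" "\<And>j. j \<in> {1..K} \<Longrightarrow> 0 < \<alpha> j"
    and P: "\<And>\<epsilon>. \<epsilon> > 0 \<Longrightarrow> prob_space (P \<epsilon>)"
    and indep: "\<And>\<epsilon>. \<epsilon> > 0 \<Longrightarrow> prob_space.indep_vars (P \<epsilon>) (\<lambda>_. borel) (X \<epsilon>) {1..K}"
    and distr: "\<And>\<epsilon> j. \<epsilon> > 0 \<Longrightarrow> j \<in> {1..K} \<Longrightarrow> distr (P \<epsilon>) borel (X \<epsilon> j) = \<mu> (\<epsilon> / \<alpha> j)"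
    and \<kappa>: "0 < \<kappa>"
  obtains N where "0 < N" "eventually (\<lambda>\<epsilon>. (\<integral>\<omega>. (INS_estimator I F K \<alpha> \<epsilon> (\<lambda>j. X \<epsilon> j \<omega>))\<^sup>2 \<partial>P \<epsilon>)
      \<le> N * exp (- (V_F I F K \<alpha> - \<kappa>) / \<epsilon>)) (at_right 0)"
proof -
  note I_meas [measurable] = rate_function_borel_measurable[OF I(1)]
  define V where "V = V_F I F K \<alpha>"
  obtain b where "\<And>x. b \<le> F x" using F(2) by (auto simp: bdd_below_def)
  then have B: "- (- b) \<le> F x" for x by simp
  define S where "S = (\<Sum>j=1..K. \<alpha> j)"
  have S: "0 < S" unfolding S_def using K \<alpha>(2) by (intro sum_pos) auto
  \<comment> \<open>Chosen so that the exponents \<open>2 * \<delta> * \<alpha> j\<close> of the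
    tilt integrals add up to \<open>\<kappa>\<close>.\<close>
  define \<delta> where "\<delta> = \<kappa> / (2 * S)"
  have \<delta>: "0 < \<delta>" "2 * \<delta> * S = \<kappa>" using \<kappa> S by (auto simp: \<delta>_def)
  have \<alpha>K: "0 < \<alpha> K" using \<alpha>(2) K by simp
  \<comment> \<open>The tail of coordinate \<open>j\<close> has exponent
    \<open>(\<delta> * real n - 1) * \<alpha> j\<close>, the 1 being the loss in the large deviation
    bound. It has to reach \<open>V - 2 * b\<close> even for the smallest value
    \<open>\<alpha> K\<close>; the absolute value keeps \<open>h\<close> nonnegative.\<close>
  define h where "h = \<bar>V - 2 * b\<bar> / \<alpha> K"
  have h: "0 \<le> h" using \<alpha>K by (simp add: h_def)
  define n where "n = nat \<lceil>(1 + h) / \<delta>\<rceil>"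
  have "(1 + h) / \<delta> \<le> real n" unfolding n_def by linarith
  then have n: "1 + h \<le> \<delta> * real n" using \<delta> by (simp add: field_simps)
  let ?A = "{x. ennreal (\<delta> * real n) \<le> I x \<and> I x < \<infinity>}"
  \<comment> \<open>A factor \<open>n\<close> comes from each of the \<open>K\<close> tilt
    integrals, and \<open>K\<close> tail terms are added.\<close>
  define N where "N = (fact K)\<^sup>2 * (real n ^ K + real K)"
  have "0 < N" unfolding N_def using K by (intro mult_pos_pos add_nonneg_pos) auto
  have tilt: "eventually (\<lambda>\<epsilon>. (\<integral>x. rate_tilt I n \<delta> (\<epsilon> / \<alpha> j) x \<partial>\<mu> (\<epsilon> / \<alpha> j))
      \<le> real n * exp (2 * \<delta> / (\<epsilon> / \<alpha> j))) (at_right 0)" if "j \<in> {1..K}" for j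
    using eventually_at_right_0_divide[OF rate_tilt_integral_le[OF I LDP \<mu> \<delta>(1)] \<alpha>(2)[OF that]] .
  have tail: "eventually (\<lambda>\<epsilon>. measure (\<mu> (\<epsilon> / \<alpha> j)) ?A
      \<le> exp (- (\<delta> * real n - 1) / (\<epsilon> / \<alpha> j))) (at_right 0)" if "j \<in> {1..K}" for j
    using \<delta>(1) by (intro eventually_at_right_0_divide[OF satisfies_LDP_finite_rate_ge[OF I LDP \<mu>] \<alpha>(2)[OF that]]) auto
  have "eventually (\<lambda>\<epsilon>. \<forall>j\<in>{1..K}. (\<integral>x. rate_tilt I n \<delta> (\<epsilon> / \<alpha> j) x \<partial>\<mu> (\<epsilon> / \<alpha> j))
      \<le> real n * exp (2 * \<delta> / (\<epsilon> / \<alpha> j)) \<and> measure (\<mu> (\<epsilon> / \<alpha> j)) ?A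
      \<le> exp (- (\<delta> * real n - 1) / (\<epsilon> / \<alpha> j))) (at_right 0)"
    using tilt tail by (intro eventually_ball_finite ballI eventually_conj) auto
  then have "eventually (\<lambda>\<epsilon>. (\<integral>\<omega>. (INS_estimator I F K \<alpha> \<epsilon> (\<lambda>j. X \<epsilon> j \<omega>))\<^sup>2 \<partial>P \<epsilon>)
      \<le> N * exp (- (V - \<kappa>) / \<epsilon>)) (at_right 0)"
  proof (rule eventually_rev_mp[OF _ eventually_mono[OF eventually_at_right_less[of 0]]], intro impI)
    fix \<epsilon> :: real
    assume \<epsilon>: "0 < \<epsilon>"
      and le: "\<forall>j\<in>{1..K}. (\<integral>x. rate_tilt I n \<delta> (\<epsilon> / \<alpha> j) x \<partial>\<mu> (\<epsilon> / \<alpha> j))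
      \<le> real n * exp (2 * \<delta> / (\<epsilon> / \<alpha> j)) \<and> measure (\<mu> (\<epsilon> / \<alpha> j)) ?A
      \<le> exp (- (\<delta> * real n - 1) / (\<epsilon> / \<alpha> j))"
    interpret prob_space "P \<epsilon>" using P[OF \<epsilon>] .
    have X [measurable]: "X \<epsilon> j \<in> measurable (P \<epsilon>) borel" if "j \<in> {1..K}" for j
      using indep[OF \<epsilon>] that by (auto simp: indep_vars_def)
    have \<epsilon>j: "0 < \<epsilon> / \<alpha> j" if "j \<in> {1..K}" for j using \<epsilon> \<alpha>(2)[OF that] by simp
    let ?g = "\<lambda>j \<omega>. rate_tilt I n \<delta> (\<epsilon> / \<alpha> j) (X \<epsilon> j \<omega>)"
    have g_int: "integrable (P \<epsilon>) (?g j)" if "j \<in> {1..K}" for j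
      using rate_tilt_integrable[OF I_meas \<mu>[OF \<epsilon>j[OF that]], of n \<delta> "\<epsilon> / \<alpha> j"]
      unfolding distr[OF \<epsilon> that, symmetric] using X[OF that] by (subst (asm) integrable_distr_eq) auto
    have g_le: "expectation (?g j) \<le> real n * exp (2 * \<delta> * \<alpha> j / \<epsilon>)" if "j \<in> {1..K}" for j
    proof -
      have "expectation (?g j) = (\<integral>x. rate_tilt I n \<delta> (\<epsilon> / \<alpha> j) x \<partial>\<mu> (\<epsilon> / \<alpha> j))"
        unfolding distr[OF \<epsilon> that, symmetric] using X[OF that] by (subst integral_distr) auto
      then show ?thesis using le that by simp
    qed
    have g_indep: "indep_vars (\<lambda>_. borel) ?g {1..K}"
      using indep_vars_compose2[OF indep[OF \<epsilon>], where Y = "\<lambda>j. rate_tilt I n \<delta> (\<epsilon> / \<alpha> j)"] by simp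
    have prod_int: "integrable (P \<epsilon>) (\<lambda>\<omega>. \<Prod>j=1..K. ?g j \<omega>)"
      using g_indep g_int by (intro indep_vars_integrable) auto
    have prod_le: "expectation (\<lambda>\<omega>. \<Prod>j=1..K. ?g j \<omega>) \<le> real n ^ K * exp (\<kappa> / \<epsilon>)"
    proof -
      have "expectation (\<lambda>\<omega>. \<Prod>j=1..K. ?g j \<omega>) = (\<Prod>j=1..K. expectation (?g j))"
        using g_indep g_int by (intro indep_vars_lebesgue_integral) auto
      also have "\<dots> \<le> (\<Prod>j=1..K. real n * exp (2 * \<delta> * \<alpha> j / \<epsilon>))"
        using g_le by (intro prod_mono conjI Bochner_Integration.integral_nonneg rate_tilt_nonneg) auto
      also have "\<dots> = real n ^ K * exp (2 * \<delta> * S / \<epsilon>)"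
        by (simp add: prod.distrib exp_sum[symmetric] S_def sum_distrib_left sum_divide_distrib)
      finally show ?thesis by (simp only: \<delta>(2))
    qed
    let ?i = "\<lambda>j \<omega>. indicator ?A (X \<epsilon> j \<omega>) :: real"
    have A: "X \<epsilon> j -` ?A \<inter> space (P \<epsilon>) \<in> events" if "j \<in> {1..K}" for j
      using X[OF that] by measurable
    have i_eq: "?i j = indicator (X \<epsilon> j -` ?A)" for j by (auto simp: indicator_def)
    have i_int: "integrable (P \<epsilon>) (?i j)" if "j \<in> {1..K}" for j
      unfolding i_eq using A[OF that] by (subst integrable_indicator_iff) (simp_all add: emeasure_eq_measure)
    have i_le: "expectation (?i j) \<le> exp (- (V - 2 * b) / \<epsilon>)" if j: "j \<in> {1..K}" for j
    proof -
      have "expectation (?i j) = measure (\<mu> (\<epsilon> / \<alpha> j)) ?A"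
        unfolding i_eq distr[OF \<epsilon> j, symmetric] using X[OF j]
        by (subst measure_distr) auto
      also have "\<dots> \<le> exp (- (\<delta> * real n - 1) / (\<epsilon> / \<alpha> j))" using le j by blast
      also have "\<dots> \<le> exp (- (V - 2 * b) / \<epsilon>)"
      proof -
        have "\<alpha> K \<le> \<alpha> j" using \<alpha>(1) j K by (auto simp: monotone_on_def)
        have "V - 2 * b \<le> h * \<alpha> K" using \<alpha>K by (simp add: h_def)
        also have "\<dots> \<le> (\<delta> * real n - 1) * \<alpha> j"
          using n h \<open>\<alpha> K \<le> \<alpha> j\<close> \<alpha>K by (intro mult_mono) auto
        finally have "- ((\<delta> * real n - 1) * \<alpha> j) / \<epsilon> \<le> - (V - 2 * b) / \<epsilon>"
          using \<epsilon> by (intro divide_right_mono) auto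
        moreover have "- (\<delta> * real n - 1) / (\<epsilon> / \<alpha> j) = - ((\<delta> * real n - 1) * \<alpha> j) / \<epsilon>"
          by (simp only: divide_divide_eq_right mult_minus_left)
        ultimately have "- (\<delta> * real n - 1) / (\<epsilon> / \<alpha> j) \<le> - (V - 2 * b) / \<epsilon>" by simp
        then show ?thesis by (simp only: exp_le_cancel_iff)
      qed
      finally show ?thesis .
    qed
    have "expectation (\<lambda>\<omega>. (INS_estimator I F K \<alpha> \<epsilon> (\<lambda>j. X \<epsilon> j \<omega>))\<^sup>2) \<le>
      expectation (\<lambda>\<omega>. (fact K)\<^sup>2 * (exp (- V / \<epsilon>) * (\<Prod>j=1..K. ?g j \<omega>) + exp (2 * (- b) / \<epsilon>) * (\<Sum>j=1..K. ?i j \<omega>)))"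
    proof (rule integral_mono)
      show "integrable (P \<epsilon>) (\<lambda>\<omega>. (INS_estimator I F K \<alpha> \<epsilon> (\<lambda>j. X \<epsilon> j \<omega>))\<^sup>2)"
        using X F(1) K by (intro INS_estimator_square_integrable[OF \<epsilon> B]) auto
      show "integrable (P \<epsilon>) (\<lambda>\<omega>. (fact K)\<^sup>2 * (exp (- V / \<epsilon>) * (\<Prod>j=1..K. ?g j \<omega>) + exp (2 * (- b) / \<epsilon>) * (\<Sum>j=1..K. ?i j \<omega>)))"
        using prod_int i_int by (intro integrable_mult_right Bochner_Integration.integrable_add Bochner_Integration.integrable_sum)
      show "(INS_estimator I F K \<alpha> \<epsilon> (\<lambda>j. X \<epsilon> j \<omega>))\<^sup>2 \<le>
        (fact K)\<^sup>2 * (exp (- V / \<epsilon>) * (\<Prod>j=1..K. ?g j \<omega>) + exp (2 * (- b) / \<epsilon>) * (\<Sum>j=1..K. ?i j \<omega>))" for \<omega>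
        unfolding V_def by (rule INS_estimator_square_le[OF \<epsilon> \<delta>(1) K \<alpha> B])
    qed
    also have "\<dots> = (fact K)\<^sup>2 * (exp (- V / \<epsilon>) * expectation (\<lambda>\<omega>. \<Prod>j=1..K. ?g j \<omega>)
        + exp (2 * (- b) / \<epsilon>) * (\<Sum>j=1..K. expectation (?i j)))"
      using prod_int i_int
      by (subst integral_mult_right_zero, subst Bochner_Integration.integral_add) (auto intro!: Bochner_Integration.integrable_sum integrable_mult_right)
    also have "\<dots> \<le> (fact K)\<^sup>2 * (exp (- V / \<epsilon>) * (real n ^ K * exp (\<kappa> / \<epsilon>))
        + exp (2 * (- b) / \<epsilon>) * (of_nat (card {1..K}) * exp (- (V - 2 * b) / \<epsilon>)))"
      using prod_le i_le by (intro mult_left_mono add_mono sum_bounded_above) auto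
    also have "\<dots> = (fact K)\<^sup>2 * (real n ^ K * exp (- (V - \<kappa>) / \<epsilon>) + real K * exp (- V / \<epsilon>))"
    \<comment> \<open>The \<open>2 * b\<close> of the crude bound cancels against the tail exponent,
      while the tilts contribute \<open>\<kappa>\<close>.\<close>
    proof -
      have "exp (- V / \<epsilon>) * exp (\<kappa> / \<epsilon>) = exp (- (V - \<kappa>) / \<epsilon>)"
        by (simp add: exp_add[symmetric] diff_divide_distrib)
      moreover have "exp (2 * (- b) / \<epsilon>) * exp (- (V - 2 * b) / \<epsilon>) = exp (- V / \<epsilon>)"
        by (simp add: exp_add[symmetric] diff_divide_distrib)
      ultimately show ?thesis
        by (simp only: mult.left_commute[of "exp _" "real _"] mult.left_commute[of "exp _" "real _ ^ _"] card_atLeastAtMost) simp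
    qed
    also have "\<dots> \<le> (fact K)\<^sup>2 * (real n ^ K * exp (- (V - \<kappa>) / \<epsilon>) + real K * exp (- (V - \<kappa>) / \<epsilon>))"
    proof (intro mult_left_mono add_left_mono)
      have "- V / \<epsilon> \<le> - (V - \<kappa>) / \<epsilon>" using \<epsilon> \<kappa> by (intro divide_right_mono) auto
      then show "exp (- V / \<epsilon>) \<le> exp (- (V - \<kappa>) / \<epsilon>)" by (simp only: exp_le_cancel_iff)
    qed auto
    also have "\<dots> = N * exp (- (V - \<kappa>) / \<epsilon>)" by (simp add: N_def algebra_simps)
    finally show "expectation (\<lambda>\<omega>. (INS_estimator I F K \<alpha> \<epsilon> (\<lambda>j. X \<epsilon> j \<omega>))\<^sup>2) \<le> N * exp (- (V - \<kappa>) / \<epsilon>)" .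
  qed
  then show ?thesis unfolding V_def by (rule that[OF \<open>0 < N\<close>])
qed

section \<open>Lower bound for the second moment\<close>

text \<open>A permutation optimal for \<open>J'\<close> is a competitor for \<open>J\<close>, and
  raising every entry by \<open>\<delta>\<close> raises its cost by \<open>\<delta>\<close> times
  the sum of \<open>\<alpha>\<close>.\<close>

lemma min_cost_le_add:
  assumes "\<And>j. j \<in> {1..K} \<Longrightarrow> 0 \<le> \<alpha> j" "\<And>j. j \<in> {1..K} \<Longrightarrow> J j \<le> J' j + \<delta>"
  shows "min_cost \<alpha> K J \<le> min_cost \<alpha> K J' + \<delta> * (\<Sum>j=1..K. \<alpha> j)"
proof -
  obtain \<sigma> where \<sigma>: "\<sigma> permutes {1..K}" "min_cost \<alpha> K J' = perm_cost \<alpha> K J' \<sigma>"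
    using min_cost_attained .
  have "perm_cost \<alpha> K J \<sigma> \<le> (\<Sum>j=1..K. \<alpha> j * (J' (\<sigma> j) + \<delta>))"
    unfolding perm_cost_def
    using assms permutes_in_image[OF \<sigma>(1)] by (intro sum_mono mult_left_mono) auto
  also have "\<dots> = min_cost \<alpha> K J' + \<delta> * (\<Sum>j=1..K. \<alpha> j)"
    by (simp add: \<sigma>(2) perm_cost_def algebra_simps sum.distrib sum_distrib_left)
  finally show ?thesis using min_cost_le[OF \<sigma>(1), of \<alpha> J] by simp
qed

text \<open>\<open>I\<close> is continuous only along its domain of finiteness, so \<open>U\<close>
  controls it at points of finite rate, while \<open>F\<close> is controlled on all of
  \<open>U\<close>.\<close>

lemma rate_nbhd:
  fixes F :: "'a::topological_space \<Rightarrow> real"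
  assumes I: "continuous_on {x. I x < \<infinity>} I" and F: "continuous_on UNIV F"
    and y: "I y < \<infinity>" and \<delta>: "0 < \<delta>"
  obtains U where "open U" "y \<in> U"
    "\<And>z. z \<in> U \<Longrightarrow> I z < \<infinity> \<Longrightarrow> \<bar>enn2real (I z) - enn2real (I y)\<bar> < \<delta>"
    "\<And>z. z \<in> U \<Longrightarrow> \<bar>F z - F y\<bar> < \<delta>"
proof -
  let ?D = "{x. I x < \<infinity>}"
  have "(I \<longlongrightarrow> I y) (at y within ?D)"
    using I y by (simp add: continuous_on_def)
  then have "((\<lambda>x. enn2real (I x)) \<longlongrightarrow> enn2real (I y)) (at y within ?D)"
    using y by (intro tendsto_enn2real) auto
  then have "eventually (\<lambda>x. \<bar>enn2real (I x) - enn2real (I y)\<bar> < \<delta>) (at y within ?D)"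
    using \<delta> by (auto simp: tendsto_iff dist_real_def)
  then obtain U where U: "open U" "y \<in> U"
      "\<And>z. z \<in> U \<Longrightarrow> z \<noteq> y \<Longrightarrow> z \<in> ?D \<Longrightarrow> \<bar>enn2real (I z) - enn2real (I y)\<bar> < \<delta>"
    unfolding eventually_at_topological by blast
  define W where "W = F -` {F y - \<delta> <..< F y + \<delta>}"
  have "open W" unfolding W_def using F by (intro open_vimage) auto
  \<comment> \<open>The punctured limit says nothing at \<open>z = y\<close>, where the difference
    is 0.\<close>
  moreover have "\<bar>enn2real (I z) - enn2real (I y)\<bar> < \<delta>" if "z \<in> U" "I z < \<infinity>" for z
    using U(3)[of z] that \<delta> by (cases "z = y") auto
  ultimately show ?thesis
    using U(1,2) \<delta> by (intro that[of "U \<inter> W"]) (auto simp: W_def)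
qed

text \<open>\<open>z\<close> is close to the rearrangement of \<open>x\<close> by
  \<open>\<tau>\<close>, so the term of \<open>inv \<tau>\<close> restores the order of
  \<open>x\<close> and evaluates \<open>F\<close> near \<open>x 1\<close>. The losses are
  \<open>\<delta> * S\<close> in \<open>perm_cost\<close>, \<open>\<delta> * S\<close> in
  \<open>min_cost\<close> and \<open>\<delta>\<close> in \<open>F\<close>.\<close>

lemma INS_estimator_square_ge:
  assumes \<epsilon>: "0 < \<epsilon>" and K: "1 \<le> K" and \<alpha>: "\<And>j. j \<in> {1..K} \<Longrightarrow> 0 \<le> \<alpha> j"
    and \<tau>: "\<tau> permutes {1..K}"
    and fin: "\<And>j. j \<in> {1..K} \<Longrightarrow> I (z j) < \<infinity>"
    and I: "\<And>j. j \<in> {1..K} \<Longrightarrow> \<bar>enn2real (I (z j)) - enn2real (I (x (\<tau> j)))\<bar> \<le> \<delta>"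
    and F: "\<And>j. j \<in> {1..K} \<Longrightarrow> F (z j) \<le> F (x (\<tau> j)) + \<delta>"
  defines "J \<equiv> \<lambda>j. enn2real (I (x j))" and "S \<equiv> \<Sum>j=1..K. \<alpha> j"
  shows "exp (- 2 * ((\<Sum>j=1..K. \<alpha> j * J j) - min_cost \<alpha> K J + F (x 1) + (2 * S + 1) * \<delta>) / \<epsilon>) / (fact K)\<^sup>2
    \<le> (INS_estimator I F K \<alpha> \<epsilon> z)\<^sup>2"
proof -
  define \<sigma> where "\<sigma> = inv \<tau>"
  define H where "H j = enn2real (I (z j))" for j
  have \<sigma>: "\<sigma> permutes {1..K}" unfolding \<sigma>_def by (rule permutes_inv[OF \<tau>])
  have im: "\<sigma> j \<in> {1..K} \<longleftrightarrow> j \<in> {1..K}" for j by (rule permutes_in_image[OF \<sigma>])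
  have \<tau>\<sigma>: "\<tau> (\<sigma> j) = j" for j unfolding \<sigma>_def by (rule permutes_inverses[OF \<tau>])
  have "perm_cost \<alpha> K H \<sigma> \<le> (\<Sum>j=1..K. \<alpha> j * (J j + \<delta>))"
    unfolding perm_cost_def
  proof (intro sum_mono mult_left_mono \<alpha>)
    fix j assume "j \<in> {1..K}"
    then show "H (\<sigma> j) \<le> J j + \<delta>"
      using I[of "\<sigma> j"] im[of j] by (simp add: \<tau>\<sigma> H_def J_def)
  qed
  also have "\<dots> = (\<Sum>j=1..K. \<alpha> j * J j) + \<delta> * S"
    by (simp add: S_def algebra_simps sum.distrib sum_distrib_left)
  finally have 1: "perm_cost \<alpha> K H \<sigma> \<le> (\<Sum>j=1..K. \<alpha> j * J j) + \<delta> * S" .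
  have "min_cost \<alpha> K J = min_cost \<alpha> K (\<lambda>j. J (\<tau> j))" by (rule min_cost_permute[OF \<tau>, symmetric])
  also have "\<dots> \<le> min_cost \<alpha> K H + \<delta> * S"
    unfolding S_def
  proof (rule min_cost_le_add[OF \<alpha>])
    fix j assume "j \<in> {1..K}"
    then show "J (\<tau> j) \<le> H j + \<delta>" using I[of j] by (simp add: H_def J_def)
  qed
  finally have 2: "min_cost \<alpha> K J \<le> min_cost \<alpha> K H + \<delta> * S" .
  have 3: "F (z (\<sigma> 1)) \<le> F (x 1) + \<delta>" using F[of "\<sigma> 1"] im[of 1] K by (simp add: \<tau>\<sigma>)
  define G where "G = (\<Sum>j=1..K. \<alpha> j * J j) - min_cost \<alpha> K J + F (x 1) + (2 * S + 1) * \<delta>"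
  have "perm_cost \<alpha> K H \<sigma> - min_cost \<alpha> K H + F (z (\<sigma> 1)) \<le> G"
    unfolding G_def using 1 2 3 by (simp add: algebra_simps)
  then have "- G / \<epsilon> \<le> - (perm_cost \<alpha> K H \<sigma> - min_cost \<alpha> K H + F (z (\<sigma> 1))) / \<epsilon>"
    using \<epsilon> by (intro divide_right_mono) auto
  then have "exp (- G / \<epsilon>) / fact K \<le> exp (- (perm_cost \<alpha> K H \<sigma> - min_cost \<alpha> K H + F (z (\<sigma> 1))) / \<epsilon>) / fact K"
    by (intro divide_right_mono) (simp_all only: exp_le_cancel_iff, simp)
  also have "\<dots> \<le> INS_estimator I F K \<alpha> \<epsilon> z"
    unfolding H_def using \<epsilon> \<alpha> fin \<sigma> by (intro INS_estimator_ge)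
  finally have "(exp (- G / \<epsilon>) / fact K)\<^sup>2 \<le> (INS_estimator I F K \<alpha> \<epsilon> z)\<^sup>2"
    by (intro power_mono) auto
  moreover have "(exp (- G / \<epsilon>) / fact K)\<^sup>2 = exp (- 2 * G / \<epsilon>) / (fact K)\<^sup>2"
    by (simp add: power_divide exp_double[symmetric])
  ultimately show ?thesis by (simp add: G_def)
qed

text \<open>Let \<open>\<tau>\<close> attain the minimum \<open>M\<close> for a nearly optimal
  \<open>x\<close>. The coordinates are near \<open>x (\<tau> j)\<close> with probability of
  exponent about \<open>M\<close>, and there the estimator has exponent about
  \<open>(\<Sum>j=1..K. \<alpha> j * J j) - M + F (x 1)\<close>. Twice the latter plus
  \<open>M\<close> is the excess cost plus \<open>2 * F (x 1)\<close>, which is close to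
  \<open>V\<close>.\<close>

lemma INS_second_moment_lower:
  fixes I :: "'a::t2_space \<Rightarrow> ennreal"
  assumes I: "rate_function I" "continuous_on {x. I x < \<infinity>} I" and LDP: "satisfies_LDP \<mu> I"
    and \<mu>: "\<And>\<epsilon>. \<epsilon> > 0 \<Longrightarrow> prob_space (\<mu> \<epsilon>)" "\<And>\<epsilon>. \<epsilon> > 0 \<Longrightarrow> sets (\<mu> \<epsilon>) = sets borel"
      "\<And>\<epsilon>. \<epsilon> > 0 \<Longrightarrow> measure (\<mu> \<epsilon>) {x. I x = \<infinity>} = 0"
    and F: "continuous_on UNIV F" "bdd_below (range F)"
    and K: "1 \<le> K" and \<alpha>: "antimono_on {1..K} \<alpha>" "\<And>j. j \<in> {1..K} \<Longrightarrow> 0 < \<alpha> j"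
    and P: "\<And>\<epsilon>. \<epsilon> > 0 \<Longrightarrow> prob_space (P \<epsilon>)"
    and indep: "\<And>\<epsilon>. \<epsilon> > 0 \<Longrightarrow> prob_space.indep_vars (P \<epsilon>) (\<lambda>_. borel) (X \<epsilon>) {1..K}"
    and distr: "\<And>\<epsilon> j. \<epsilon> > 0 \<Longrightarrow> j \<in> {1..K} \<Longrightarrow> distr (P \<epsilon>) borel (X \<epsilon> j) = \<mu> (\<epsilon> / \<alpha> j)"
    and \<kappa>: "0 < \<kappa>"
  obtains c where "0 < c" "eventually (\<lambda>\<epsilon>. c * exp (- (V_F I F K \<alpha> + \<kappa>) / \<epsilon>)
      \<le> (\<integral>\<omega>. (INS_estimator I F K \<alpha> \<epsilon> (\<lambda>j. X \<epsilon> j \<omega>))\<^sup>2 \<partial>P \<epsilon>)) (at_right 0)"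
proof -
  note I_meas [measurable] = rate_function_borel_measurable[OF I(1)]
  have F_meas: "F \<in> borel_measurable borel" using F(1) by (rule borel_measurable_continuous_onI)
  define V where "V = V_F I F K \<alpha>"
  obtain b where "\<And>x. b \<le> F x" using F(2) by (auto simp: bdd_below_def)
  then have B: "- (- b) \<le> F x" for x by simp
  have "measure (\<mu> \<epsilon>) UNIV = 1" if "0 < \<epsilon>" for \<epsilon>
    using prob_space.prob_space[OF \<mu>(1)[OF that]] sets_eq_imp_space_eq[OF \<mu>(2)[OF that]] by simp
  then obtain x0 where "I x0 = 0" using satisfies_LDP_rate_zero[OF I LDP] by blast
  moreover have "V < V + \<kappa> / 2" using \<kappa> by simp
  ultimately obtain x where x: "\<And>j. I (x j) < \<infinity>"
      "excess_cost \<alpha> K (\<lambda>j. enn2real (I (x j))) + 2 * F (x 1) < V + \<kappa> / 2"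
    using V_F_approx[OF K \<alpha>(1) less_imp_le[OF \<alpha>(2)], of I x0 F] unfolding V_def by blast
  define J where "J j = enn2real (I (x j))" for j
  define M where "M = min_cost \<alpha> K J"
  obtain \<tau> where \<tau>: "\<tau> permutes {1..K}" "M = perm_cost \<alpha> K J \<tau>"
    unfolding M_def using min_cost_attained .
  define S where "S = (\<Sum>j=1..K. \<alpha> j)"
  have S: "0 < S" unfolding S_def using K \<alpha>(2) by (intro sum_pos) auto
  \<comment> \<open>The squared pointwise bound loses \<open>2 * (2 * S + 1) * \<delta>\<close> and
    the probability \<open>S * \<delta>\<close>, together half of \<open>\<kappa>\<close>; the other
    half pays for the near optimality of \<open>x\<close>.\<close>
  define \<delta> where "\<delta> = \<kappa> / (2 * (5 * S + 2))"
  have \<delta>: "0 < \<delta>" "(5 * S + 2) * \<delta> = \<kappa> / 2" using \<kappa> S by (auto simp: \<delta>_def field_simps)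
  define G where "G = (\<Sum>j=1..K. \<alpha> j * J j) - M + F (x 1) + (2 * S + 1) * \<delta>"
  have "\<forall>j. \<exists>U. open U \<and> x (\<tau> j) \<in> U \<and>
    (\<forall>z\<in>U. I z < \<infinity> \<longrightarrow> \<bar>enn2real (I z) - J (\<tau> j)\<bar> < \<delta>) \<and> (\<forall>z\<in>U. \<bar>F z - F (x (\<tau> j))\<bar> < \<delta>)"
    unfolding J_def using rate_nbhd[OF I(2) F(1) x(1) \<delta>(1)] by metis
  then obtain U where U: "\<And>j. open (U j)" "\<And>j. x (\<tau> j) \<in> U j"
      "\<And>j z. z \<in> U j \<Longrightarrow> I z < \<infinity> \<Longrightarrow> \<bar>enn2real (I z) - J (\<tau> j)\<bar> < \<delta>"
      "\<And>j z. z \<in> U j \<Longrightarrow> \<bar>F z - F (x (\<tau> j))\<bar> < \<delta>"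
    by metis
  \<comment> \<open>The pointwise bound needs finite rates. The removed points form a null set, so
    \<open>D j\<close> is as likely as \<open>U j\<close>.\<close>
  define D where "D j = {z \<in> U j. I z < \<infinity>}" for j
  have D_meas: "D j \<in> sets borel" for j
    using U(1)[of j] unfolding D_def by (auto simp: borel_open)
  have "eventually (\<lambda>\<epsilon>. \<forall>j\<in>{1..K}. exp (- (J (\<tau> j) + \<delta>) / (\<epsilon> / \<alpha> j)) \<le> measure (\<mu> (\<epsilon> / \<alpha> j)) (U j)) (at_right 0)"
    unfolding J_def
    using eventually_at_right_0_divide[OF satisfies_LDP_open[OF LDP U(1) U(2) x(1) \<delta>(1)] \<alpha>(2)]
    by (intro eventually_ball_finite) auto
  then have "eventually (\<lambda>\<epsilon>. 1 / (fact K)\<^sup>2 * exp (- (V + \<kappa>) / \<epsilon>)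
      \<le> (\<integral>\<omega>. (INS_estimator I F K \<alpha> \<epsilon> (\<lambda>j. X \<epsilon> j \<omega>))\<^sup>2 \<partial>P \<epsilon>)) (at_right 0)"
  proof (rule eventually_rev_mp[OF _ eventually_mono[OF eventually_at_right_less[of 0]]], intro impI)
    fix \<epsilon> :: real
    assume \<epsilon>: "0 < \<epsilon>"
      and ge: "\<forall>j\<in>{1..K}. exp (- (J (\<tau> j) + \<delta>) / (\<epsilon> / \<alpha> j)) \<le> measure (\<mu> (\<epsilon> / \<alpha> j)) (U j)"
    interpret prob_space "P \<epsilon>" using P[OF \<epsilon>] .
    have X: "X \<epsilon> j \<in> measurable (P \<epsilon>) borel" if "j \<in> {1..K}" for j
      using indep[OF \<epsilon>] that by (auto simp: indep_vars_def)
    define A where "A = (\<Inter>j\<in>{1..K}. X \<epsilon> j -` D j \<inter> space (P \<epsilon>))"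
    have A_meas: "A \<in> events"
      unfolding A_def using K X D_meas by (intro sets.finite_INT) (auto intro: measurable_sets)
    have D_ge: "exp (- (\<alpha> j * J (\<tau> j) + \<alpha> j * \<delta>) / \<epsilon>) \<le> prob (X \<epsilon> j -` D j \<inter> space (P \<epsilon>))"
      if j: "j \<in> {1..K}" for j
    proof -
      have \<epsilon>j: "0 < \<epsilon> / \<alpha> j" using \<epsilon> \<alpha>(2)[OF j] by simp
      interpret \<mu>j: prob_space "\<mu> (\<epsilon> / \<alpha> j)" using \<mu>(1)[OF \<epsilon>j] .
      have "exp (- (\<alpha> j * J (\<tau> j) + \<alpha> j * \<delta>) / \<epsilon>) = exp (- (J (\<tau> j) + \<delta>) / (\<epsilon> / \<alpha> j))"
        by (simp add: algebra_simps)
      also have "\<dots> \<le> measure (\<mu> (\<epsilon> / \<alpha> j)) (U j)" using ge j by blast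
      also have "\<dots> \<le> measure (\<mu> (\<epsilon> / \<alpha> j)) (D j \<union> {z. I z = \<infinity>})"
        using D_meas[of j] unfolding D_def
        by (intro \<mu>j.finite_measure_mono) (auto simp: \<mu>(2)[OF \<epsilon>j] less_top[symmetric])
      also have "\<dots> \<le> measure (\<mu> (\<epsilon> / \<alpha> j)) (D j) + measure (\<mu> (\<epsilon> / \<alpha> j)) {z. I z = \<infinity>}"
        using D_meas[of j] by (intro measure_Un_le) (auto simp: \<mu>(2)[OF \<epsilon>j])
      also have "\<dots> = prob (X \<epsilon> j -` D j \<inter> space (P \<epsilon>))"
        unfolding \<mu>(3)[OF \<epsilon>j] unfolding distr[OF \<epsilon> j, symmetric]
        using X[OF j] D_meas[of j] by (simp add: measure_distr)
      finally show ?thesis .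
    qed
    \<comment> \<open>The exponents of the coordinates sum to \<open>M\<close> because
      \<open>\<tau>\<close> attains the minimum.\<close>
    have "exp (- (M + \<delta> * S) / \<epsilon>) = (\<Prod>j=1..K. exp (- (\<alpha> j * J (\<tau> j) + \<alpha> j * \<delta>) / \<epsilon>))"
    proof -
      have "M + \<delta> * S = (\<Sum>j=1..K. \<alpha> j * J (\<tau> j) + \<alpha> j * \<delta>)"
        by (simp add: \<tau>(2) perm_cost_def S_def sum.distrib sum_distrib_left mult.commute)
      then have "- (M + \<delta> * S) / \<epsilon> = (\<Sum>j=1..K. - (\<alpha> j * J (\<tau> j) + \<alpha> j * \<delta>) / \<epsilon>)"
        by (simp only: sum_divide_distrib[symmetric] sum_negf)
      then show ?thesis by (simp only: exp_sum finite_atLeastAtMost)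
    qed
    also have "\<dots> \<le> (\<Prod>j=1..K. prob (X \<epsilon> j -` D j \<inter> space (P \<epsilon>)))"
      using D_ge by (intro prod_mono) auto
    also have "\<dots> = prob A"
      unfolding A_def using K D_meas by (intro indep_varsD_finite[OF indep[OF \<epsilon>], symmetric]) auto
    finally have prob_A: "exp (- (M + \<delta> * S) / \<epsilon>) \<le> prob A" .
    have "- (V + \<kappa>) \<le> - 2 * G - (M + \<delta> * S)"
      using x(2) \<delta>(2) unfolding G_def J_def[abs_def, symmetric] excess_cost_def M_def[symmetric]
      by (simp add: algebra_simps)
    then have "- (V + \<kappa>) / \<epsilon> \<le> (- 2 * G - (M + \<delta> * S)) / \<epsilon>"
      using \<epsilon> by (intro divide_right_mono) auto
    also have "\<dots> = - 2 * G / \<epsilon> + - (M + \<delta> * S) / \<epsilon>"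
      by (simp add: diff_divide_distrib add_divide_distrib)
    finally have "exp (- (V + \<kappa>) / \<epsilon>) \<le> exp (- 2 * G / \<epsilon>) * exp (- (M + \<delta> * S) / \<epsilon>)"
      by (simp only: exp_add[symmetric] exp_le_cancel_iff)
    also have "\<dots> \<le> exp (- 2 * G / \<epsilon>) * prob A" using prob_A by (intro mult_left_mono) auto
    finally have "1 / (fact K)\<^sup>2 * exp (- (V + \<kappa>) / \<epsilon>) \<le> 1 / (fact K)\<^sup>2 * (exp (- 2 * G / \<epsilon>) * prob A)"
      by (intro mult_left_mono) auto
    also have "\<dots> = expectation (\<lambda>\<omega>. exp (- 2 * G / \<epsilon>) / (fact K)\<^sup>2 * indicator A \<omega>)"
      using sets.sets_into_space[OF A_meas] by (simp add: Int_absorb2)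
    also have "\<dots> \<le> expectation (\<lambda>\<omega>. (INS_estimator I F K \<alpha> \<epsilon> (\<lambda>j. X \<epsilon> j \<omega>))\<^sup>2)"
    proof (rule integral_mono)
      show "integrable (P \<epsilon>) (\<lambda>\<omega>. exp (- 2 * G / \<epsilon>) / (fact K)\<^sup>2 * indicator A \<omega>)"
        using A_meas by (intro integrable_mult_right integrable_real_indicator) (simp_all add: emeasure_eq_measure)
      show "integrable (P \<epsilon>) (\<lambda>\<omega>. (INS_estimator I F K \<alpha> \<epsilon> (\<lambda>j. X \<epsilon> j \<omega>))\<^sup>2)"
        using X F_meas K by (intro INS_estimator_square_integrable[OF \<epsilon> B]) auto
      fix \<omega>
      show "exp (- 2 * G / \<epsilon>) / (fact K)\<^sup>2 * indicator A \<omega> \<le> (INS_estimator I F K \<alpha> \<epsilon> (\<lambda>j. X \<epsilon> j \<omega>))\<^sup>2"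
      proof (cases "\<omega> \<in> A")
        case True
        then have D: "X \<epsilon> j \<omega> \<in> U j" "I (X \<epsilon> j \<omega>) < \<infinity>" if "j \<in> {1..K}" for j
          using that by (auto simp: A_def D_def)
        have "exp (- 2 * G / \<epsilon>) / (fact K)\<^sup>2 \<le> (INS_estimator I F K \<alpha> \<epsilon> (\<lambda>j. X \<epsilon> j \<omega>))\<^sup>2"
          unfolding G_def M_def J_def[abs_def] S_def
        proof (rule INS_estimator_square_ge[OF \<epsilon> K less_imp_le[OF \<alpha>(2)] \<tau>(1)])
          fix j assume j: "j \<in> {1..K}"
          show "I (X \<epsilon> j \<omega>) < \<infinity>" using D(2)[OF j] .
          show "\<bar>enn2real (I (X \<epsilon> j \<omega>)) - enn2real (I (x (\<tau> j)))\<bar> \<le> \<delta>"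
            using U(3)[OF D[OF j]] by (simp add: J_def)
          show "F (X \<epsilon> j \<omega>) \<le> F (x (\<tau> j)) + \<delta>" using U(4)[OF D(1)[OF j]] by linarith
        qed
        with True show ?thesis by simp
      qed simp
    qed
    finally show "1 / (fact K)\<^sup>2 * exp (- (V + \<kappa>) / \<epsilon>)
        \<le> expectation (\<lambda>\<omega>. (INS_estimator I F K \<alpha> \<epsilon> (\<lambda>j. X \<epsilon> j \<omega>))\<^sup>2)" .
  qed
  then show ?thesis unfolding V_def by (intro that[of "1 / (fact K)\<^sup>2"]) auto
qed

section \<open>Passage to the logarithmic limit\<close>

text \<open>Multiplicative constants disappear as \<open>\<epsilon> * ln c\<close> tends to 0; half
  of the error \<open>e\<close> is given to \<open>\<kappa>\<close> and half to this term. The lower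
  bound keeps \<open>E \<epsilon>\<close> positive, where \<open>ln\<close> is monotone.\<close>

lemma tendsto_neg_eps_ln:
  fixes E :: "real \<Rightarrow> real"
  assumes upper: "\<And>\<kappa>. 0 < \<kappa> \<Longrightarrow> \<exists>N>0. eventually (\<lambda>\<epsilon>. E \<epsilon> \<le> N * exp (- (V - \<kappa>) / \<epsilon>)) (at_right 0)"
    and lower: "\<And>\<kappa>. 0 < \<kappa> \<Longrightarrow> \<exists>c>0. eventually (\<lambda>\<epsilon>. c * exp (- (V + \<kappa>) / \<epsilon>) \<le> E \<epsilon>) (at_right 0)"
  shows "((\<lambda>\<epsilon>. - \<epsilon> * ln (E \<epsilon>)) \<longlongrightarrow> V) (at_right 0)"
proof -
  have small: "eventually (\<lambda>\<epsilon>. \<bar>\<epsilon> * ln c\<bar> < \<kappa>) (at_right 0)" if "0 < \<kappa>" for c \<kappa> :: real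
  proof -
    have "((\<lambda>\<epsilon>. \<epsilon> * ln c) \<longlongrightarrow> 0 * ln c) (at_right 0)" by (intro tendsto_intros)
    then show ?thesis using that by (auto simp: tendsto_iff dist_real_def)
  qed
  have ln_exp: "\<epsilon> * ln (c * exp (- v / \<epsilon>)) = \<epsilon> * ln c - v" if "0 < c" "0 < \<epsilon>" for c v \<epsilon> :: real
    using that by (simp add: ln_mult field_simps)
  show ?thesis
  proof (rule tendstoI)
    fix e :: real assume e: "0 < e"
    obtain N where N: "0 < N" "eventually (\<lambda>\<epsilon>. E \<epsilon> \<le> N * exp (- (V - e / 2) / \<epsilon>)) (at_right 0)"
      using upper[of "e / 2"] e by auto
    obtain c where c: "0 < c" "eventually (\<lambda>\<epsilon>. c * exp (- (V + e / 2) / \<epsilon>) \<le> E \<epsilon>) (at_right 0)"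
      using lower[of "e / 2"] e by auto
    have e2: "0 < e / 2" using e by simp
    show "eventually (\<lambda>\<epsilon>. dist (- \<epsilon> * ln (E \<epsilon>)) V < e) (at_right 0)"
      using N(2) c(2) small[OF e2, of N] small[OF e2, of c] eventually_at_right_less[of 0]
    proof eventually_elim
      case (elim \<epsilon>)
      have "0 < c * exp (- (V + e / 2) / \<epsilon>)" using c(1) by simp
      then have pos: "0 < E \<epsilon>" using elim(2) by linarith
      have "\<epsilon> * ln (E \<epsilon>) \<le> \<epsilon> * ln (N * exp (- (V - e / 2) / \<epsilon>))"
        using elim pos N(1) by (intro mult_left_mono ln_mono) auto
      then have "\<epsilon> * ln (E \<epsilon>) \<le> \<epsilon> * ln N - (V - e / 2)"
        by (simp only: ln_exp[OF N(1) elim(5)])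
      moreover have "\<epsilon> * ln (c * exp (- (V + e / 2) / \<epsilon>)) \<le> \<epsilon> * ln (E \<epsilon>)"
        using elim pos c(1) by (intro mult_left_mono ln_mono) auto
      then have "\<epsilon> * ln c - (V + e / 2) \<le> \<epsilon> * ln (E \<epsilon>)"
        by (simp only: ln_exp[OF c(1) elim(5)])
      ultimately show ?case
        using elim(3,4) unfolding dist_real_def mult_minus_left by arith
    qed
  qed
qed

theorem theorem3p2:
  fixes \<gamma> :: "'a::polish_space measure"
    and I :: "'a \<Rightarrow> ennreal"
    and F :: "'a \<Rightarrow> real"
    and \<mu> :: "real \<Rightarrow> 'a measure"
    and K :: nat
    and \<alpha> :: "nat \<Rightarrow> real"
    and P :: "real \<Rightarrow> 'w measure"
    and X :: "real \<Rightarrow> nat \<Rightarrow> 'w \<Rightarrow> 'a"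
  assumes "sets \<gamma> = sets borel"
    and "rate_function I"
    and "continuous_on {x. I x < \<infinity>} I"
    and "\<And>\<epsilon>. \<epsilon> > 0 \<Longrightarrow> 0 < gibbs_Z \<gamma> I \<epsilon> \<and> gibbs_Z \<gamma> I \<epsilon> < \<infinity>"
    and "\<And>\<epsilon>. \<epsilon> > 0 \<Longrightarrow> prob_space (\<mu> \<epsilon>)"
    and "\<And>\<epsilon>. \<epsilon> > 0 \<Longrightarrow> \<mu> \<epsilon> = gibbs_measure \<gamma> I \<epsilon>"
    and "satisfies_LDP \<mu> I"
    and "continuous_on UNIV F"
    and "bdd_below (range F)"
    and "K \<ge> 1"
    and "\<alpha> 1 = 1"
    and "antimono_on {1..K} \<alpha>"
    and "\<And>j. j \<in> {1..K} \<Longrightarrow> \<alpha> j > 0"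
    and "\<And>\<epsilon>. \<epsilon> > 0 \<Longrightarrow> prob_space (P \<epsilon>)"
    and "\<And>\<epsilon>. \<epsilon> > 0 \<Longrightarrow> prob_space.indep_vars (P \<epsilon>) (\<lambda>_. borel) (X \<epsilon>) {1..K}"
    and "\<And>\<epsilon> j. \<epsilon> > 0 \<Longrightarrow> j \<in> {1..K} \<Longrightarrow> distr (P \<epsilon>) borel (X \<epsilon> j) = \<mu> (\<epsilon> / \<alpha> j)"
  shows "((\<lambda>\<epsilon>. - \<epsilon> * ln (prob_space.expectation (P \<epsilon>)
            (\<lambda>\<omega>. (INS_estimator I F K \<alpha> \<epsilon> (\<lambda>j. X \<epsilon> j \<omega>))\<^sup>2)))
          \<longlongrightarrow> V_F I F K \<alpha>) (at_right 0)"
proof (rule tendsto_neg_eps_ln)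
  note I = assms(2,3) and LDP = assms(7) and K = assms(10) and \<alpha> = assms(12,13)
  have sets: "sets (\<mu> \<epsilon>) = sets borel" if "0 < \<epsilon>" for \<epsilon>
    using assms(1) by (simp add: assms(6)[OF that] gibbs_measure_def)
  have fin: "finite_measure (\<mu> \<epsilon>)" if "0 < \<epsilon>" for \<epsilon>
    using assms(5)[OF that] by (rule prob_space.finite_measure)
  have "I \<in> borel_measurable \<gamma>"
    using rate_function_borel_measurable[OF I(1)] by (simp add: measurable_cong_sets[OF assms(1) refl])
  from gibbs_measure_infinite_rate[OF this]
  have inf: "measure (\<mu> \<epsilon>) {x. I x = \<infinity>} = 0" if "0 < \<epsilon>" for \<epsilon>
    using that sets_eq_imp_space_eq[OF assms(1)] by (simp add: assms(6))
  have F_meas: "F \<in> borel_measurable borel" using assms(8) by (rule borel_measurable_continuous_onI)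
  fix \<kappa> :: real assume \<kappa>: "0 < \<kappa>"
  show "\<exists>N>0. eventually (\<lambda>\<epsilon>. (\<integral>\<omega>. (INS_estimator I F K \<alpha> \<epsilon> (\<lambda>j. X \<epsilon> j \<omega>))\<^sup>2 \<partial>P \<epsilon>)
      \<le> N * exp (- (V_F I F K \<alpha> - \<kappa>) / \<epsilon>)) (at_right 0)"
    using INS_second_moment_upper[OF I LDP fin sets F_meas assms(9) K \<alpha> assms(14-16) \<kappa>] by blast
  show "\<exists>c>0. eventually (\<lambda>\<epsilon>. c * exp (- (V_F I F K \<alpha> + \<kappa>) / \<epsilon>)
      \<le> (\<integral>\<omega>. (INS_estimator I F K \<alpha> \<epsilon> (\<lambda>j. X \<epsilon> j \<omega>))\<^sup>2 \<partial>P \<epsilon>)) (at_right 0)"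
    using INS_second_moment_lower[OF I LDP assms(5) sets inf assms(8,9) K \<alpha> assms(14-16) \<kappa>] by blast
qed

end
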